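(* Let $f:\mathbb{R}\to\{-1,+1\}$ be a (possibly random) label function, $S\sim\mathcal{N}(0,1)$, $Y=f(S)$, with $\mathbb{E}[SY]>0$ and such that $SY$ has a density that is differentiable on $\mathbb{R}$. Set $$\xi:=(\mathcal{I}(SY)-1)\,\frac{1-(\mathbb{E}[SY])^2}{(\mathbb{E}[SY])^2}.$$ Then for every $\delta>1$, $$\frac{\sigma_{\rm LS}^2}{\sigma_{\rm opt}^2}\le\xi\qquad\text{and}\qquad \frac{\mathrm{corr}_{\rm opt}}{\mathrm{corr}_{\rm LS}}\le\sqrt{\xi}.$$ In particular, for every $\delta>1$, $\mathrm{corr}_{\rm LS}\ge 0.9972\cdot\mathrm{corr}_{\rm opt}$ for the Logistic model and $\mathrm{corr}_{\rm LS}\ge0.9804\cdot\mathrm{corr}_{\rm opt}$ for the Probit model.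
   Context: Logistic model: $\Pr(f(s)=+1)=\frac{1}{1+e^{-s}}$ and $f(s)=-1$ otherwise. Probit model: $\Pr(f(s)=+1)=\Phi(s)$ and $f(s)=-1$ otherwise, with $\Phi$ the standard normal c.d.f. $\sigma_{\rm LS}:=\alpha/\mu$ with $\mu=\mathbb{E}[SY]$ and $\alpha=\sqrt{1-(\mathbb{E}[SY])^2}\cdot\sqrt{\frac{1}{\delta-1}}$, and $\mathrm{corr}_{\rm LS}:=1/\sqrt{1+\sigma_{\rm LS}^2}$; this is the almost sure limit (as $m,n\to\infty$, $m/n\to\delta$) of the correlation $\frac{\langle\widehat{\mathbf{x}},\mathbf{x}_0\rangle}{\|\widehat{\mathbf{x}}\|_2\|\mathbf{x}_0\|_2}$ of the least-squares estimate $\widehat{\mathbf{x}}=\arg\min_{\mathbf{x}}\sum_{i=1}^m(y_i-\mathbf{a}_i^T\mathbf{x})^2$, where $y_i=f(\mathbf{a}_i^T\mathbf{x}_0)$, $\|\mathbf{x}_0\|_2=1$ and $\mathbf{a}_i\in\mathbb{R}^n$ have i.i.d. standard normal entries. For a random variable $H$ with differentiable density $p_H$, $\mathcal{I}(H)=\mathbb{E}[(p_H'(H)/p_H(H))^2]$ is the Fisher information. With $G\sim\mathcal{N}(0,1)$ independent of $(S,Y)$ and $W_\sigma:=\sigma G+SY$, let $$\kappa(\sigma):=\frac{\sigma^2\left(\sigma^2\mathcal{I}(W_\sigma)+\mathcal{I}(W_\sigma)-1\right)}{1+\sigma^2\left(\sigma^2\mathcal{I}(W_\sigma)-1\right)}\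 (\sigma>0),\quad \kappa(0):=0,\qquad \sigma_{\rm opt}:=\min\{\sigma\ge0:\kappa(\sigma)=1/\delta\},$$ and $\mathrm{corr}_{\rm opt}:=1/\sqrt{1+\sigma_{\rm opt}^2}$, the upper bound on the asymptotic correlation over convex loss functions. *)

theory Defs
  imports "HOL-Probability.Probability"
begin

text \<open>A differentiable density is determined by the law of \<open>H\<close>: two continuous densities agree
  almost everywhere, hence everywhere. So the description operator in \<open>diff_density\<close> is
  well defined as soon as a differentiable density exists.\<close>

definition is_diff_density :: "'a measure \<Rightarrow> ('a \<Rightarrow> real) \<Rightarrow> (real \<Rightarrow> real) \<Rightarrow> bool" where
  "is_diff_density M H p \<longleftrightarrow>
     distributed M lborel H (\<lambda>x. ennreal (p x)) \<and>
     (\<forall>x. 0 \<le> p x) \<and> (\<forall>x. p differentiable (at x))"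

definition has_diff_density :: "'a measure \<Rightarrow> ('a \<Rightarrow> real) \<Rightarrow> bool" where
  "has_diff_density M H \<longleftrightarrow> (\<exists>p. is_diff_density M H p)"

definition diff_density :: "'a measure \<Rightarrow> ('a \<Rightarrow> real) \<Rightarrow> real \<Rightarrow> real" where
  "diff_density M H = (THE p. is_diff_density M H p)"

text \<open>The expectation is that of a nonnegative variable, so it is a Lebesgue integral with values
  in \<open>[0, \<infinity>]\<close>; in particular infinite Fisher information is not collapsed to \<open>0\<close>.\<close>

definition fisher_info :: "'a measure \<Rightarrow> ('a \<Rightarrow> real) \<Rightarrow> ennreal" where
  "fisher_info M H =
     (\<integral>\<^sup>+\<omega>. ennreal ((deriv (diff_density M H) (H \<omega>) / diff_density M H (H \<omega>))\<^sup>2) \<partial>M)"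

definition mean_SY :: "'a measure \<Rightarrow> ('a \<Rightarrow> real) \<Rightarrow> ('a \<Rightarrow> real) \<Rightarrow> real" where
  "mean_SY M S Y = (\<integral>\<omega>. S \<omega> * Y \<omega> \<partial>M)"

definition alpha_LS :: "'a measure \<Rightarrow> ('a \<Rightarrow> real) \<Rightarrow> ('a \<Rightarrow> real) \<Rightarrow> real \<Rightarrow> real" where
  "alpha_LS M S Y \<delta> = sqrt (1 - (mean_SY M S Y)\<^sup>2) * sqrt (1 / (\<delta> - 1))"

definition sigma_LS :: "'a measure \<Rightarrow> ('a \<Rightarrow> real) \<Rightarrow> ('a \<Rightarrow> real) \<Rightarrow> real \<Rightarrow> real" where
  "sigma_LS M S Y \<delta> = alpha_LS M S Y \<delta> / mean_SY M S Y"

definition corr_LS :: "'a measure \<Rightarrow> ('a \<Rightarrow> real) \<Rightarrow> ('a \<Rightarrow> real) \<Rightarrow> real \<Rightarrow> real" where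
  "corr_LS M S Y \<delta> = 1 / sqrt (1 + (sigma_LS M S Y \<delta>)\<^sup>2)"

definition W_var ::
  "('a \<Rightarrow> real) \<Rightarrow> ('a \<Rightarrow> real) \<Rightarrow> ('a \<Rightarrow> real) \<Rightarrow> real \<Rightarrow> 'a \<Rightarrow> real" where
  "W_var S Y G \<sigma> = (\<lambda>\<omega>. \<sigma> * G \<omega> + S \<omega> * Y \<omega>)"

text \<open>For \<open>\<sigma> > 0\<close> the variable \<open>W_var S Y G \<sigma>\<close> has a smooth positive density and Fisher
  information at most \<open>1 / \<sigma>\<^sup>2\<close>, so \<open>enn2real\<close> loses nothing.\<close>

definition kappa ::
  "'a measure \<Rightarrow> ('a \<Rightarrow> real) \<Rightarrow> ('a \<Rightarrow> real) \<Rightarrow> ('a \<Rightarrow> real) \<Rightarrow> real \<Rightarrow> real" where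
  "kappa M S Y G \<sigma> =
     (if \<sigma> = 0 then 0
      else let I = enn2real (fisher_info M (W_var S Y G \<sigma>)) in
        \<sigma>\<^sup>2 * (\<sigma>\<^sup>2 * I + I - 1) / (1 + \<sigma>\<^sup>2 * (\<sigma>\<^sup>2 * I - 1)))"

definition sigma_opt ::
  "'a measure \<Rightarrow> ('a \<Rightarrow> real) \<Rightarrow> ('a \<Rightarrow> real) \<Rightarrow> ('a \<Rightarrow> real) \<Rightarrow> real \<Rightarrow> real" where
  "sigma_opt M S Y G \<delta> = (LEAST \<sigma>. 0 \<le> \<sigma> \<and> kappa M S Y G \<sigma> = 1 / \<delta>)"

definition corr_opt ::
  "'a measure \<Rightarrow> ('a \<Rightarrow> real) \<Rightarrow> ('a \<Rightarrow> real) \<Rightarrow> ('a \<Rightarrow> real) \<Rightarrow> real \<Rightarrow> real" where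
  "corr_opt M S Y G \<delta> = 1 / sqrt (1 + (sigma_opt M S Y G \<delta>)\<^sup>2)"

text \<open>Extended real, because the Fisher information of \<open>SY\<close> may be infinite.\<close>

definition xi :: "'a measure \<Rightarrow> ('a \<Rightarrow> real) \<Rightarrow> ('a \<Rightarrow> real) \<Rightarrow> ereal" where
  "xi M S Y =
     (enn2ereal (fisher_info M (\<lambda>\<omega>. S \<omega> * Y \<omega>)) - 1) *
     ereal ((1 - (mean_SY M S Y)\<^sup>2) / (mean_SY M S Y)\<^sup>2)"

definition ereal_sqrt :: "ereal \<Rightarrow> ereal" where
  "ereal_sqrt x = (if x = \<infinity> then \<infinity> else ereal (sqrt (real_of_ereal x)))"

text \<open>The library's \<open>indep_var\<close> forces both variables to have the same codomain type. This is the
  same notion for two variables of different types.\<close>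

definition indep_rv ::
  "'a measure \<Rightarrow> 'b measure \<Rightarrow> ('a \<Rightarrow> 'b) \<Rightarrow> 'c measure \<Rightarrow> ('a \<Rightarrow> 'c) \<Rightarrow> bool" where
  "indep_rv M A X B Z \<longleftrightarrow>
     X \<in> M \<rightarrow>\<^sub>M A \<and> Z \<in> M \<rightarrow>\<^sub>M B \<and>
     prob_space.indep_set M {X -` E \<inter> space M | E. E \<in> sets A} {Z -` E \<inter> space M | E. E \<in> sets B}"

text \<open>A possibly random label function is a jointly measurable \<open>f\<close> with an extra argument, a random
  seed \<open>U\<close> with values in an arbitrary measurable space \<open>N\<close> and independent of \<open>S\<close>. The random
  label \<open>f(s)\<close> is \<open>\<lambda>\<omega>. f (U \<omega>) s\<close>, and \<open>Y = f(S)\<close>. A deterministic label function ignores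
  the seed.\<close>

definition random_label_model ::
  "'a measure \<Rightarrow> 'u measure \<Rightarrow> ('a \<Rightarrow> 'u) \<Rightarrow> ('u \<Rightarrow> real \<Rightarrow> real) \<Rightarrow>
     ('a \<Rightarrow> real) \<Rightarrow> ('a \<Rightarrow> real) \<Rightarrow> bool" where
  "random_label_model M N U f S Y \<longleftrightarrow>
     (\<lambda>(u, s). f u s) \<in> N \<Otimes>\<^sub>M borel \<rightarrow>\<^sub>M borel \<and>
     (\<forall>u\<in>space N. \<forall>s. f u s \<in> {-1, 1}) \<and>
     indep_rv M N U borel S \<and>
     distributed M lborel S (\<lambda>x. ennreal (std_normal_density x)) \<and>
     (\<forall>\<omega>\<in>space M. Y \<omega> = f (U \<omega>) (S \<omega>))"

definition logistic_model :: "'a measure \<Rightarrow> ('a \<Rightarrow> 'u) \<Rightarrow> ('u \<Rightarrow> real \<Rightarrow> real) \<Rightarrow> bool" where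
  "logistic_model M U f \<longleftrightarrow>
     (\<forall>s. measure M {\<omega> \<in> space M. f (U \<omega>) s = 1} = 1 / (1 + exp (- s)))"

definition probit_model :: "'a measure \<Rightarrow> ('a \<Rightarrow> 'u) \<Rightarrow> ('u \<Rightarrow> real \<Rightarrow> real) \<Rightarrow> bool" where
  "probit_model M U f \<longleftrightarrow>
     (\<forall>s. measure M {\<omega> \<in> space M. f (U \<omega>) s = 1} = cdf std_normal_distribution s)"

end

theory Submission
  imports Defs
begin

text \<open>
  Let \<open>V = S Y\<close>, \<open>\<mu> = E V\<close>, \<open>v = 1 - \<mu>\<^sup>2\<close> (its variance, as \<open>V\<^sup>2 = S\<^sup>2\<close>), let \<open>J\<close> be the Fisher
  information of \<open>V\<close> and \<open>I(\<sigma>)\<close> that of \<open>\<sigma> G + V\<close>. The proof traps \<open>I(\<sigma>)\<close> between two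
  classical bounds,
  \<open>1 / (\<sigma>\<^sup>2 + v) \<le> I(\<sigma>) \<le> J / (1 + \<sigma>\<^sup>2 J)\<close>,
  the Cramer-Rao inequality (\<open>Cramer_Rao\<close>) and Stam's inequality (\<open>Stam\<close>). Since \<open>\<kappa>\<close> is an
  increasing function of the Fisher information, inserting them gives
  \<open>\<sigma>\<^sup>2 \<mu>\<^sup>2 / (v + \<sigma>\<^sup>2 \<mu>\<^sup>2) \<le> \<kappa>(\<sigma>) \<le> \<sigma>\<^sup>2 (J - 1) / (1 + \<sigma>\<^sup>2 (J - 1))\<close>.
  The left side reaches \<open>1 / \<delta>\<close> exactly at the least-squares value \<open>\<sigma>\<^sup>2 = v / (\<mu>\<^sup>2 (\<delta> - 1))\<close>, and
  the right side at \<open>\<sigma>\<^sup>2 = 1 / ((J - 1) (\<delta> - 1))\<close>. As \<open>I\<close> is continuous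
  (\<open>continuous_smooth_fisher\<close>), a least solution of \<open>\<kappa>(\<sigma>) = 1 / \<delta>\<close> exists and lies between these
  two values (\<open>kappa_least_solution\<close>); their quotient is \<open>\<xi>\<close>, which is the first claim. In
  particular \<open>\<xi> \<ge> 1\<close>, and the bound on the correlations follows.

  In the logistic and probit models the probability \<open>q(s)\<close> of the label \<open>1\<close> satisfies
  \<open>q(- s) = 1 - q(s)\<close>. Then \<open>V\<close> has density \<open>2 \<phi> q\<close>, and \<open>\<mu>\<close> and \<open>J\<close> are Gaussian integrals of
  \<open>q'\<close> (\<open>symmetric_label_bound\<close>). Each numerical constant comes from one pointwise estimate
  with explicit Gaussian integrals: for the logistic model \<open>1 / C \<ge> 2 g - C g\<^sup>2\<close> with a Gaussian
  \<open>g\<close> (\<open>logistic_deriv_lower\<close>), and for the probit model Polya's inequality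
  \<open>4 \<Phi>(x) (1 - \<Phi>(x)) \<ge> exp (- 2 x\<^sup>2 / \<pi>)\<close> (\<open>Polya\<close>).
\<close>

section \<open>Convolution on the real line\<close>

definition fconv :: "(real \<Rightarrow> real) \<Rightarrow> (real \<Rightarrow> real) \<Rightarrow> real \<Rightarrow> real" where
  "fconv h g x = (\<integral>y. h (x - y) * g y \<partial>lborel)"

lemma fconv_integrand_integrable:
  fixes h g :: "real \<Rightarrow> real"
  assumes [measurable]: "h \<in> borel_measurable borel" and "\<And>z. \<bar>h z\<bar> \<le> B"
    and g: "integrable lborel g"
  shows "integrable lborel (\<lambda>y. h (x - y) * g y)"
proof (rule Bochner_Integration.integrable_bound[of _ "\<lambda>y. B * g y"])
  have [measurable]: "g \<in> borel_measurable borel" using g by auto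
  show "integrable lborel (\<lambda>y. B * g y)" using g by simp
  show "(\<lambda>y. h (x - y) * g y) \<in> borel_measurable lborel" by measurable
  have "\<bar>B\<bar> = B" using assms(2)[of 0] by auto
  then show "AE y in lborel. norm (h (x - y) * g y) \<le> norm (B * g y)"
    using assms(2) by (auto simp: abs_mult intro!: mult_right_mono)
qed

lemma fconv_measurable [measurable]:
  assumes [measurable]: "h \<in> borel_measurable borel" "g \<in> borel_measurable borel"
  shows "fconv h g \<in> borel_measurable borel"
  unfolding fconv_def[abs_def] by measurable

text \<open>Convolving integrable functions multiplies their integrals. Every moment computation for a
  smoothed density below is an instance: a polynomial in \<open>x\<close> is expanded in \<open>x - y\<close> and
  \<open>y\<close>, and each resulting term is a convolution.\<close>

lemma fconv_integrable:
  assumes h: "integrable lborel h" and g: "integrable lborel g"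
  shows "integrable lborel (fconv h g)"
    and "(\<integral>x. fconv h g x \<partial>lborel) = (\<integral>x. h x \<partial>lborel) * (\<integral>x. g x \<partial>lborel)"
proof -
  have [measurable]: "h \<in> borel_measurable borel" "g \<in> borel_measurable borel"
    using h g by auto
  have sh: "integrable lborel (\<lambda>x. h (x - y))" for y
    using lborel_integrable_real_affine_iff[of 1 h "-y"] h by simp
  have shn: "(\<integral>x. h' (x - y) \<partial>lborel) = (\<integral>x. h' x \<partial>lborel)" for y and h' :: "real \<Rightarrow> real"
    using lborel_integral_real_affine[of 1 h' "-y"] by simp
  have 1: "integrable (lborel \<Otimes>\<^sub>M lborel) (\<lambda>(y, x). h (x - y) * g y)"
  proof (rule lborel_pair.Fubini_integrable)
    show "(\<lambda>(y, x). h (x - y) * g y) \<in> borel_measurable (lborel \<Otimes>\<^sub>M lborel)" by measurable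
    have "(\<integral>x. norm (h (x - y) * g y) \<partial>lborel) = (\<integral>x. \<bar>h x\<bar> \<partial>lborel) * \<bar>g y\<bar>" for y
      using shn[of "\<lambda>x. \<bar>h x\<bar>" y] by (simp add: abs_mult)
    then show "integrable lborel (\<lambda>y. \<integral>x. norm (case (y, x) of (y, x) \<Rightarrow> h (x - y) * g y) \<partial>lborel)"
      using g by simp
    show "AE y in lborel. integrable lborel (\<lambda>x. case (y, x) of (y, x) \<Rightarrow> h (x - y) * g y)"
      using sh by simp
  qed
  have eq: "fconv h g = (\<lambda>x. \<integral>y. h (x - y) * g y \<partial>lborel)" by (auto simp: fconv_def)
  show "integrable lborel (fconv h g)"
    unfolding eq using lborel_pair.integrable_snd[OF 1] .
  have "(\<integral>x. fconv h g x \<partial>lborel) = (\<integral>y. \<integral>x. h (x - y) * g y \<partial>lborel \<partial>lborel)"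
    unfolding eq using lborel_pair.Fubini_integral[OF 1] by simp
  also have "\<dots> = (\<integral>y. (\<integral>x. h x \<partial>lborel) * g y \<partial>lborel)" by (simp add: shn)
  finally show "(\<integral>x. fconv h g x \<partial>lborel) = (\<integral>x. h x \<partial>lborel) * (\<integral>x. g x \<partial>lborel)" by simp
qed

text \<open>Only the kernels vary, under a common bound, so dominated convergence applies at every
  single point; the bound on the kernels is what avoids an almost-everywhere statement.\<close>

lemma fconv_tendsto:
  assumes [measurable]: "\<And>n. h n \<in> borel_measurable borel" "h' \<in> borel_measurable borel"
    and B: "\<And>n z. \<bar>h n z\<bar> \<le> B" and lim: "\<And>z. (\<lambda>n. h n z) \<longlonglongrightarrow> h' z"
    and g: "integrable lborel g"
  shows "(\<lambda>n. fconv (h n) g x) \<longlonglongrightarrow> fconv h' g x"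
  unfolding fconv_def
proof (rule integral_dominated_convergence[where w="\<lambda>y. B * \<bar>g y\<bar>"])
  have [measurable]: "g \<in> borel_measurable borel" using g by auto
  show "(\<lambda>y. h' (x - y) * g y) \<in> borel_measurable lborel"
       "(\<lambda>y. h i (x - y) * g y) \<in> borel_measurable lborel" for i by measurable
  show "integrable lborel (\<lambda>y. B * \<bar>g y\<bar>)" using g by simp
  show "AE y in lborel. (\<lambda>i. h i (x - y) * g y) \<longlonglongrightarrow> h' (x - y) * g y"
    by (intro AE_I2 tendsto_mult lim tendsto_const)
  show "AE y in lborel. norm (h i (x - y) * g y) \<le> B * \<bar>g y\<bar>" for i
    using B by (auto simp: abs_mult intro!: mult_right_mono)
qed

lemma fconv_has_derivative:
  assumes der: "\<And>z. (h has_real_derivative h' z) (at z)"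
    and m[measurable]: "h' \<in> borel_measurable borel"
    and b: "\<And>z. \<bar>h z\<bar> \<le> B0" and B: "\<And>z. \<bar>h' z\<bar> \<le> B" and g: "integrable lborel g"
  shows "(fconv h g has_real_derivative fconv h' g x) (at x)"
  unfolding DERIV_def tendsto_at_iff_sequentially comp_def
proof (intro allI impI)
  fix s :: "nat \<Rightarrow> real" assume s: "\<forall>i. s i \<in> UNIV - {0}" "s \<longlonglongrightarrow> 0"
  have [measurable]: "h \<in> borel_measurable borel"
    by (intro borel_measurable_continuous_onI) (meson DERIV_isCont continuous_at_imp_continuous_on der)
  have "(\<lambda>n. fconv (\<lambda>z. (h (z + s n) - h z) / s n) g x) \<longlonglongrightarrow> fconv h' g x"
  proof (rule fconv_tendsto[OF _ m _ _ g])
    fix n z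
    show "\<bar>(h (z + s n) - h z) / s n\<bar> \<le> B"
    proof -
      have "\<bar>h (z + s n) - h z\<bar> \<le> B * \<bar>(z + s n) - z\<bar>"
        using field_differentiable_bound[of UNIV h h' B "z + s n" z] der B
        by (auto simp: has_field_derivative_at_within)
      then show ?thesis using s(1) by (auto simp: abs_divide divide_simps)
    qed
    show "(\<lambda>n. (h (z + s n) - h z) / s n) \<longlonglongrightarrow> h' z"
      using der[of z] s unfolding DERIV_def tendsto_at_iff_sequentially comp_def by auto
  qed measurable
  moreover have "fconv (\<lambda>z. (h (z + s n) - h z) / s n) g x = (fconv h g (x + s n) - fconv h g x) / s n" for n
  proof -
    have "integrable lborel (\<lambda>y. h (x + s n - y) * g y)" "integrable lborel (\<lambda>y. h (x - y) * g y)"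
      by (auto intro!: fconv_integrand_integrable b g)
    then show ?thesis
      unfolding fconv_def by (simp add: algebra_simps diff_divide_distrib)
  qed
  ultimately show "(\<lambda>n. (fconv h g (x + s n) - fconv h g x) / s n) \<longlonglongrightarrow> fconv h' g x" by simp
qed

text \<open>\<open>F'\<close> need not be continuous and no decay of \<open>F\<close> is known beforehand, so boundary terms are
  avoided: averaging \<open>F'\<close> over unit intervals turns it into \<open>F (x + 1) - F x\<close>, whose integral
  vanishes by translation invariance, while averaging preserves the integral of \<open>F'\<close>.\<close>

lemma integral_derivative_eq_0:
  fixes F F' :: "real \<Rightarrow> real"
  assumes der: "\<And>x. (F has_real_derivative F' x) (at x)"
    and F: "integrable lborel F" and F': "integrable lborel F'"
  shows "(\<integral>x. F' x \<partial>lborel) = 0"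
proof -
  have "fconv (indicator {-1..0}) F' x = F (x + 1) - F x" for x
  proof -
    have "set_integrable lborel {x..x+1} F'"
      using F' integrable_mult_indicator[of "{x..x+1}" lborel F'] by (simp add: set_integrable_def)
    have "(F' has_integral (LINT y:{x..x+1}|lborel. F' y)) {x..x+1}"
      using set_borel_integral_eq_integral[OF \<open>set_integrable lborel {x..x+1} F'\<close>]
      by (metis integrable_integral)
    moreover have "(F' has_integral (F (x+1) - F x)) {x..x+1}"
      by (intro fundamental_theorem_of_calculus)
         (auto simp: has_real_derivative_iff_has_vector_derivative[symmetric] intro!: has_field_derivative_at_within der)
    ultimately have "(LINT y:{x..x+1}|lborel. F' y) = F (x + 1) - F x"
      using has_integral_unique by blast
    moreover have "fconv (indicator {-1..0}) F' x = (LINT y:{x..x+1}|lborel. F' y)"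
      unfolding fconv_def set_lebesgue_integral_def
      by (intro Bochner_Integration.integral_cong) (auto simp: indicator_def)
    ultimately show ?thesis by simp
  qed
  then have "(\<integral>x. fconv (indicator {-1..0}) F' x \<partial>lborel) = (\<integral>x. F (x + 1) - F x \<partial>lborel)" by simp
  also have "\<dots> = 0"
    using F lborel_integrable_real_affine_iff[of 1 F 1] lborel_integral_real_affine[of 1 F 1]
    by (simp add: add.commute)
  finally show ?thesis
    using fconv_integrable(2)[OF _ F', of "indicator {-1..0}"] by simp
qed

text \<open>Integration by parts. It allows the score of a smoothed density to be written with the
  derivative falling on either factor, which is the starting point of Stam's inequality.\<close>

lemma fconv_derivative_swap:
  assumes dh: "\<And>z. (h has_real_derivative h' z) (at z)" and dg: "\<And>y. (g has_real_derivative g' y) (at y)"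
    and [measurable]: "h' \<in> borel_measurable borel"
    and b: "\<And>z. \<bar>h z\<bar> \<le> B0" and B: "\<And>z. \<bar>h' z\<bar> \<le> B"
    and g: "integrable lborel g" and g': "integrable lborel g'"
  shows "fconv h' g x = fconv h g' x"
proof -
  have [measurable]: "h \<in> borel_measurable borel"
    by (intro borel_measurable_continuous_onI) (meson DERIV_isCont continuous_at_imp_continuous_on dh)
  have i: "integrable lborel (\<lambda>y. h (x - y) * g y)" "integrable lborel (\<lambda>y. h' (x - y) * g y)"
     "integrable lborel (\<lambda>y. h (x - y) * g' y)"
    by (auto intro!: fconv_integrand_integrable b B g g')
  have "(\<integral>y. h (x - y) * g' y - h' (x - y) * g y \<partial>lborel) = 0"
  proof (rule integral_derivative_eq_0[where F="\<lambda>y. h (x - y) * g y"])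
    show "((\<lambda>y. h (x - y) * g y) has_real_derivative h (x - y) * g' y - h' (x - y) * g y) (at y)" for y
      by (auto intro!: derivative_eq_intros DERIV_chain2[OF dh] dg)
    show "integrable lborel (\<lambda>y. h (x - y) * g y)" 
     "integrable lborel (\<lambda>y. h (x - y) * g' y - h' (x - y) * g y)" using i by auto
  qed
  then show ?thesis using i by (simp add: fconv_def)
qed

section \<open>Fisher information after Gaussian smoothing\<close>

text \<open>Stating the hypothesis as \<open>h\<^sup>2 \<le> k q\<close> rather than factoring \<open>h\<close> avoids square roots of
  densities. Pointwise \<open>t\<^sup>2 k - 2 t h + q \<ge> 0\<close>, and integrating gives a quadratic in \<open>t\<close>
  without sign change.\<close>

lemma Cauchy_Schwarz_pointwise:
  fixes h k q :: "'a \<Rightarrow> real"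
  assumes k: "integrable M k" and h: "integrable M h" and q: "integrable M q"
    and k0: "\<And>x. 0 \<le> k x" and q0: "\<And>x. 0 \<le> q x" and le: "\<And>x. (h x)\<^sup>2 \<le> k x * q x"
  shows "(\<integral>x. h x \<partial>M)\<^sup>2 \<le> (\<integral>x. k x \<partial>M) * (\<integral>x. q x \<partial>M)"
proof -
  define K H Q where "K = (\<integral>x. k x \<partial>M)" and "H = (\<integral>x. h x \<partial>M)" and "Q = (\<integral>x. q x \<partial>M)"
  have Q0: "0 \<le> Q" and K0: "0 \<le> K" unfolding Q_def K_def using q0 k0 by (auto intro!: Bochner_Integration.integral_nonneg)
  have quad: "0 \<le> t\<^sup>2 * K - 2 * t * H + Q" for t
  proof -
    have pt: "0 \<le> t\<^sup>2 * k x - 2 * t * h x + q x" for x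
    proof -
      have "\<bar>t * h x\<bar> \<le> sqrt (t\<^sup>2 * k x * q x)"
        using le[of x] by (intro real_le_rsqrt) (simp add: power_mult_distrib mult_left_mono mult.assoc)
      also have "\<dots> \<le> (t\<^sup>2 * k x + q x) / 2"
        using arith_geo_mean_sqrt[of "t\<^sup>2 * k x" "q x"] k0[of x] q0[of x] by simp
      finally show ?thesis by (simp add: abs_le_iff)
    qed
    have "0 \<le> (\<integral>x. t\<^sup>2 * k x - 2 * t * h x + q x \<partial>M)"
      by (intro Bochner_Integration.integral_nonneg pt)
    also have "\<dots> = t\<^sup>2 * K - 2 * t * H + Q"
      using k h q by (simp add: K_def H_def Q_def)
    finally show ?thesis .
  qed
  have "H\<^sup>2 \<le> K * Q"
  proof (cases "K = 0")
    case True
    have "H = 0"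
      \<comment> \<open>For \<open>K = 0\<close> the quadratic is linear, and its value at this point is \<open>- Q - 2\<close>.\<close>
      using quad[of "(Q + 1) / H"] True Q0 by (cases "H = 0") auto
    then show ?thesis using True by simp
  next
    case False
    then have "K > 0" using K0 by simp
    have "0 \<le> K * ((H / K)\<^sup>2 * K - 2 * (H / K) * H + Q)"
      using quad[of "H / K"] \<open>K > 0\<close> by simp
    also have "\<dots> = K * Q - H\<^sup>2" using \<open>K > 0\<close> by (simp add: field_simps power2_eq_square)
    finally show ?thesis by simp
  qed
  then show ?thesis by (simp add: K_def H_def Q_def)
qed

definition gauss_deriv :: "real \<Rightarrow> real \<Rightarrow> real" where
  "gauss_deriv \<sigma> z = - (z / \<sigma>\<^sup>2) * normal_density 0 \<sigma> z"

text \<open>The pointwise Fisher information \<open>\<phi>'\<^sup>2 / \<phi>\<close> of the centred Gaussian density \<open>\<phi>\<close> with standard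
  deviation \<open>\<sigma>\<close>.\<close>

definition gauss_info :: "real \<Rightarrow> real \<Rightarrow> real" where
  "gauss_info \<sigma> z = (z / \<sigma>\<^sup>2)\<^sup>2 * normal_density 0 \<sigma> z"

lemma gauss_deriv_measurable [measurable]: "gauss_deriv \<sigma> \<in> borel_measurable borel"
  unfolding gauss_deriv_def[abs_def] by measurable

lemma gauss_info_measurable [measurable]: "gauss_info \<sigma> \<in> borel_measurable borel"
  unfolding gauss_info_def[abs_def] by measurable

lemma gauss_info_nonneg [simp]: "0 \<le> gauss_info \<sigma> z"
  by (simp add: gauss_info_def)

lemma DERIV_gauss:
  assumes "\<sigma> > 0"
  shows "(normal_density 0 \<sigma> has_real_derivative gauss_deriv \<sigma> z) (at z)"
proof -
  have "(normal_density 0 \<sigma> has_real_derivative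
      1 / sqrt (2 * pi * \<sigma>\<^sup>2) * (exp (- (z - 0)\<^sup>2 / (2 * \<sigma>\<^sup>2)) * (- (2 * z) / (2 * \<sigma>\<^sup>2)))) (at z)"
    unfolding normal_density_def[abs_def]
    using assms by (intro DERIV_cmult) (auto intro!: derivative_eq_intros simp: field_simps power2_eq_square)
  moreover have "- (2 * z) / (2 * \<sigma>\<^sup>2) = - (z / \<sigma>\<^sup>2)"
    by simp
  ultimately show ?thesis
    by (simp add: gauss_deriv_def normal_density_def mult_ac)
qed

lemma gauss_le:
  assumes "\<sigma> > 0" shows "normal_density 0 \<sigma> z \<le> 1 / \<sigma>"
proof -
  have "\<sigma> \<le> sqrt (2 * pi * \<sigma>\<^sup>2)"
    using assms pi_ge_two by (intro real_le_rsqrt) (simp add: mult_le_cancel_right1)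
  then have "1 / sqrt (2 * pi * \<sigma>\<^sup>2) * exp (- (z - 0)\<^sup>2 / (2 * \<sigma>\<^sup>2)) \<le> 1 / \<sigma> * 1"
    using assms by (intro mult_mono) (auto simp: divide_simps)
  then show ?thesis by (simp add: normal_density_def)
qed

lemma gauss_norm_le: "\<sigma> > 0 \<Longrightarrow> \<bar>normal_density 0 \<sigma> z\<bar> \<le> 1 / \<sigma>"
  using gauss_le[of \<sigma> z] by simp

text \<open>Bounded by means of \<open>u exp (- u) \<le> 1\<close> with \<open>u = z\<^sup>2 / (2 \<sigma>\<^sup>2)\<close>.\<close>

lemma gauss_sq_le:
  assumes "\<sigma> > 0" shows "z\<^sup>2 * normal_density 0 \<sigma> z \<le> 2 * \<sigma>"
proof -
  define u where "u = z\<^sup>2 / (2 * \<sigma>\<^sup>2)"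
  have u: "z\<^sup>2 = 2 * \<sigma>\<^sup>2 * u" using assms by (simp add: u_def)
  have e: "u * exp (- u) \<le> 1"
  proof -
    have "u \<le> exp u" using exp_ge_add_one_self[of u] by linarith
    then show ?thesis by (simp add: exp_minus field_simps)
  qed
  have s: "\<sigma> \<le> sqrt (2 * pi * \<sigma>\<^sup>2)"
    using assms pi_ge_two by (intro real_le_rsqrt) (simp add: mult_le_cancel_right1)
  have "z\<^sup>2 * normal_density 0 \<sigma> z = 2 * \<sigma>\<^sup>2 * (1 / sqrt (2 * pi * \<sigma>\<^sup>2)) * (u * exp (- u))"
    by (simp add: normal_density_def u_def[symmetric] u minus_divide_left[symmetric])
  also have "\<dots> \<le> 2 * \<sigma>\<^sup>2 * (1 / \<sigma>) * 1"
    using s assms e by (intro mult_mono) (auto simp: divide_simps u_def)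
  finally show ?thesis using assms by (simp add: power2_eq_square)
qed

lemma gauss_abs_le:
  assumes "\<sigma> > 0" shows "\<bar>z\<bar> * normal_density 0 \<sigma> z \<le> 1 / \<sigma> + 2 * \<sigma>"
proof -
  have "\<bar>z\<bar> \<le> 1 + z\<^sup>2"
    using zero_le_power2[of "\<bar>z\<bar> - 1"] by (simp add: power2_diff)
  then have "\<bar>z\<bar> * normal_density 0 \<sigma> z \<le> (1 + z\<^sup>2) * normal_density 0 \<sigma> z"
    by (intro mult_right_mono) auto
  then show ?thesis using gauss_le[OF assms, of z] gauss_sq_le[OF assms, of z]
    by (simp add: algebra_simps)
qed

lemma gauss_deriv_abs_le:
  assumes "\<sigma> > 0" shows "\<bar>gauss_deriv \<sigma> z\<bar> \<le> (1 / \<sigma> + 2 * \<sigma>) / \<sigma>\<^sup>2"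
  using gauss_abs_le[OF assms, of z] assms
  by (simp add: gauss_deriv_def abs_mult divide_right_mono)

lemma gauss_info_le:
  assumes "\<sigma> > 0" shows "\<bar>gauss_info \<sigma> z\<bar> \<le> 2 * \<sigma> / \<sigma>^4"
proof -
  have "gauss_info \<sigma> z = z\<^sup>2 * normal_density 0 \<sigma> z / \<sigma>^4"
    by (simp add: gauss_info_def power_divide)
  then show ?thesis using gauss_sq_le[OF assms, of z] assms by (simp add: divide_right_mono)
qed

lemma gauss_integrals:
  assumes "\<sigma> > 0"
  shows "has_bochner_integral lborel (normal_density 0 \<sigma>) 1"
    and "has_bochner_integral lborel (\<lambda>z. z * normal_density 0 \<sigma> z) 0"
    and "has_bochner_integral lborel (\<lambda>z. z\<^sup>2 * normal_density 0 \<sigma> z) (\<sigma>\<^sup>2)"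
  using normal_moment_even[OF assms, of 0 0] normal_moment_odd[OF assms, of 0 0]
    normal_moment_even[OF assms, of 0 1]
  by (simp_all add: mult.commute power2_eq_square)

lemma gauss_deriv_integral:
  assumes "\<sigma> > 0" shows "has_bochner_integral lborel (gauss_deriv \<sigma>) 0"
  using has_bochner_integral_mult_right[OF gauss_integrals(2)[OF assms], of "- 1 / \<sigma>\<^sup>2"]
  by (simp add: gauss_deriv_def[abs_def])

lemma gauss_z_deriv_integral:
  assumes "\<sigma> > 0" shows "has_bochner_integral lborel (\<lambda>z. z * gauss_deriv \<sigma> z) (-1)"
  using has_bochner_integral_mult_right[OF gauss_integrals(3)[OF assms], of "- 1 / \<sigma>\<^sup>2"] assms
  by (simp add: gauss_deriv_def[abs_def] power2_eq_square mult.assoc)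

lemma gauss_info_integral:
  assumes "\<sigma> > 0" shows "has_bochner_integral lborel (gauss_info \<sigma>) (1 / \<sigma>\<^sup>2)"
  using has_bochner_integral_mult_right[OF gauss_integrals(3)[OF assms], of "1 / \<sigma>^4"] assms
  by (simp add: gauss_info_def[abs_def] power_divide power2_eq_square power4_eq_xxxx mult.assoc)

locale real_density =
  fixes p :: "real \<Rightarrow> real"
  assumes nonneg: "\<And>y. 0 \<le> p y" and density: "has_bochner_integral lborel p 1"
begin

lemma p_integrable [simp]: "integrable lborel p" using density by (simp add: has_bochner_integral_iff)

lemma p_measurable [measurable]: "p \<in> borel_measurable borel"
  using borel_measurable_integrable[OF p_integrable] by simp

definition smooth :: "real \<Rightarrow> real \<Rightarrow> real" where
  "smooth \<sigma> = fconv (normal_density 0 \<sigma>) p"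

definition smooth_deriv :: "real \<Rightarrow> real \<Rightarrow> real" where
  "smooth_deriv \<sigma> = fconv (gauss_deriv \<sigma>) p"

definition smooth_fisher :: "real \<Rightarrow> real" where
  "smooth_fisher \<sigma> = (\<integral>x. (smooth_deriv \<sigma> x)\<^sup>2 / smooth \<sigma> x \<partial>lborel)"

lemma smooth_measurable [measurable]: "smooth \<sigma> \<in> borel_measurable borel"
  unfolding smooth_def by measurable

lemma smooth_deriv_measurable [measurable]: "smooth_deriv \<sigma> \<in> borel_measurable borel"
  unfolding smooth_deriv_def by measurable

lemma DERIV_smooth:
  assumes "\<sigma> > 0" shows "(smooth \<sigma> has_real_derivative smooth_deriv \<sigma> x) (at x)"
  unfolding smooth_def smooth_deriv_def
  by (rule fconv_has_derivative[OF DERIV_gauss[OF assms] _ gauss_norm_le[OF assms] gauss_deriv_abs_le[OF assms]])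
     auto

lemma smooth_pos:
  assumes "\<sigma> > 0" shows "0 < smooth \<sigma> x"
proof -
  have int: "integrable lborel (\<lambda>y. normal_density 0 \<sigma> (x - y) * p y)"
    by (rule fconv_integrand_integrable[OF _ gauss_norm_le[OF assms]]) auto
  have ge: "0 \<le> smooth \<sigma> x"
    unfolding smooth_def fconv_def by (intro Bochner_Integration.integral_nonneg) (auto simp: nonneg)
  have "smooth \<sigma> x \<noteq> 0"
  proof
    assume "smooth \<sigma> x = 0"
    then have "AE y in lborel. normal_density 0 \<sigma> (x - y) * p y = 0"
      using int unfolding smooth_def fconv_def
      by (subst (asm) integral_nonneg_eq_0_iff_AE) (auto simp: nonneg)
    then have "AE y in lborel. p y = 0"
      by eventually_elim (use normal_density_pos[OF assms] in \<open>auto simp: less_le\<close>)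
    then have "(\<integral>y. p y \<partial>lborel) = 0" by (rule integral_eq_zero_AE)
    then show False using density by (simp add: has_bochner_integral_iff)
  qed
  with ge show ?thesis by simp
qed

text \<open>Smoothing does not increase information: the score of the sum is a conditional expectation of
  the Gaussian score, so its square is at most the conditional expectation of the square. The
  right-hand side is integrable and serves as dominating function.\<close>

lemma smooth_deriv_sq_le:
  assumes s: "\<sigma> > 0"
  shows "(smooth_deriv \<sigma> x)\<^sup>2 / smooth \<sigma> x \<le> fconv (gauss_info \<sigma>) p x"
proof -
  have "(smooth_deriv \<sigma> x)\<^sup>2 \<le> smooth \<sigma> x * fconv (gauss_info \<sigma>) p x"
    unfolding smooth_def smooth_deriv_def fconv_def
  proof (rule Cauchy_Schwarz_pointwise)
    show "integrable lborel (\<lambda>y. normal_density 0 \<sigma> (x - y) * p y)"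
      by (rule fconv_integrand_integrable[OF _ gauss_norm_le[OF s]]) auto
    show "integrable lborel (\<lambda>y. gauss_deriv \<sigma> (x - y) * p y)"
      by (rule fconv_integrand_integrable[OF _ gauss_deriv_abs_le[OF s]]) auto
    show "integrable lborel (\<lambda>y. gauss_info \<sigma> (x - y) * p y)"
      by (rule fconv_integrand_integrable[OF _ gauss_info_le[OF s]]) auto
    show "(gauss_deriv \<sigma> (x - y) * p y)\<^sup>2
        \<le> normal_density 0 \<sigma> (x - y) * p y * (gauss_info \<sigma> (x - y) * p y)" for y
      by (simp add: gauss_deriv_def gauss_info_def power2_eq_square mult_ac)
  qed (auto simp: nonneg)
  then show ?thesis using smooth_pos[OF s, of x] by (simp add: pos_divide_le_eq mult.commute)
qed

lemma gauss_info_fconv: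
  assumes "\<sigma> > 0"
  shows "integrable lborel (fconv (gauss_info \<sigma>) p)"
  using fconv_integrable(1)[OF _ p_integrable, of "gauss_info \<sigma>"] gauss_info_integral[OF assms]
  by (auto simp: has_bochner_integral_iff)

lemma smooth_fisher_integrable:
  assumes "\<sigma> > 0"
  shows "integrable lborel (\<lambda>x. (smooth_deriv \<sigma> x)\<^sup>2 / smooth \<sigma> x)"
proof (rule Bochner_Integration.integrable_bound[OF gauss_info_fconv[OF assms]])
  show "AE x in lborel. norm ((smooth_deriv \<sigma> x)\<^sup>2 / smooth \<sigma> x) \<le> norm (fconv (gauss_info \<sigma>) p x)"
    using smooth_deriv_sq_le[OF assms] smooth_pos[OF assms]
    by (intro AE_I2) (smt (verit, best) divide_nonneg_pos real_norm_def zero_le_power2)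
qed measurable

lemma smooth_fisher_nonneg: "0 \<le> smooth_fisher \<sigma>"
proof -
  have "0 \<le> smooth \<sigma> x" for x
    unfolding smooth_def fconv_def by (intro Bochner_Integration.integral_nonneg) (auto simp: nonneg)
  then show ?thesis
    unfolding smooth_fisher_def by (intro Bochner_Integration.integral_nonneg) auto
qed

text \<open>For \<open>\<sigma>\<close> in a compact interval \<open>[a, b]\<close> away from \<open>0\<close>, all Gaussian information kernels lie
  below one multiple \<open>H\<close> of \<open>z\<^sup>2\<close> times the density of width \<open>b\<close>, and the smoothing of
  \<open>H\<close> dominates the integrands.\<close>

lemma continuous_smooth_fisher:
  assumes s0: "\<sigma> > 0"
  shows "isCont smooth_fisher \<sigma>"
  unfolding continuous_at_sequentially comp_def
proof (intro allI impI)
  fix s :: "nat \<Rightarrow> real" assume s: "s \<longlonglongrightarrow> \<sigma>"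
  define a b where "a = \<sigma> / 2" and "b = 2 * \<sigma>"
  have ab: "0 < a" "0 < b" using s0 by (auto simp: a_def b_def)
  have "eventually (\<lambda>n. s n \<in> {a<..<b}) sequentially"
    using s s0 by (intro topological_tendstoD[OF s]) (auto simp: a_def b_def)
  then obtain n0 where n0: "\<And>n. n \<ge> n0 \<Longrightarrow> s n \<in> {a<..<b}"
    by (auto simp: eventually_sequentially)
  define t where "t n = s (n + n0)" for n
  have t: "a < t n" "t n < b" "0 < t n" for n using n0[of "n + n0"] ab by (auto simp: t_def)
  have tl: "t \<longlonglongrightarrow> \<sigma>" unfolding t_def using LIMSEQ_ignore_initial_segment[OF s] .
  define C where "C = b / a / a^4"
  define H where "H z = C * (z\<^sup>2 * normal_density 0 b z)" for z
  have C0: "0 \<le> C" using ab by (simp add: C_def)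
  have dom: "gauss_info (t n) z \<le> H z" for n z
  proof -
    have s1: "sqrt (2 * pi * r\<^sup>2) = sqrt (2 * pi) * r" if "r > 0" for r
      using that by (simp add: real_sqrt_mult)
    have e: "exp (- z\<^sup>2 / (2 * (t n)\<^sup>2)) \<le> exp (- z\<^sup>2 / (2 * b\<^sup>2))"
      using t[of n] ab by (auto intro!: divide_left_mono mult_pos_pos power_mono)
    have "1 / (sqrt (2 * pi) * t n) \<le> 1 / (sqrt (2 * pi) * a)"
      using t[of n] ab by (auto intro!: divide_left_mono mult_pos_pos mult_left_mono)
    then have "normal_density 0 (t n) z \<le> 1 / (sqrt (2 * pi) * a) * exp (- z\<^sup>2 / (2 * b\<^sup>2))"
      unfolding normal_density_def s1[OF t(3)] diff_zero
      by (rule mult_mono[OF _ e]) (use ab in auto)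
    also have "\<dots> = b / a * normal_density 0 b z"
      using ab by (simp add: normal_density_def s1)
    finally have n: "normal_density 0 (t n) z \<le> b / a * normal_density 0 b z" .
    have "(z / (t n)\<^sup>2)\<^sup>2 \<le> z\<^sup>2 / a^4"
      using t[of n] ab by (auto simp: power_divide intro!: divide_left_mono power_mono)
    then have "gauss_info (t n) z \<le> z\<^sup>2 / a^4 * (b / a * normal_density 0 b z)"
      unfolding gauss_info_def using n by (intro mult_mono) auto
    then show ?thesis by (simp add: H_def C_def mult_ac)
  qed
  have Hi: "integrable lborel H"
    using gauss_integrals(3)[OF ab(2)] unfolding H_def[abs_def] by (auto simp: has_bochner_integral_iff)
  have Hm[measurable]: "H \<in> borel_measurable borel" using Hi by auto
  have Hb: "\<bar>H z\<bar> \<le> C * (2 * b)" for z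
    using gauss_sq_le[OF ab(2), of z] C0 by (auto simp: H_def abs_mult intro!: mult_left_mono)
  have cl: "(\<lambda>n. normal_density 0 (t n) z) \<longlonglongrightarrow> normal_density 0 \<sigma> z" for z
    unfolding normal_density_def using s0 by (intro tendsto_intros tl) auto
  have cl': "(\<lambda>n. gauss_deriv (t n) z) \<longlonglongrightarrow> gauss_deriv \<sigma> z" for z
    unfolding gauss_deriv_def using s0 by (intro tendsto_intros tl cl) auto
  have wl: "(\<lambda>n. smooth (t n) x) \<longlonglongrightarrow> smooth \<sigma> x" for x
    unfolding smooth_def
  proof (rule fconv_tendsto[OF _ _ _ cl])
    fix n z
    have "normal_density 0 (t n) z \<le> 1 / t n" by (rule gauss_le[OF t(3)])
    also have "\<dots> \<le> 1 / a" using t[of n] ab by (simp add: frac_le)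
    finally show "\<bar>normal_density 0 (t n) z\<bar> \<le> 1 / a" by simp
  qed auto
  have wl': "(\<lambda>n. smooth_deriv (t n) x) \<longlonglongrightarrow> smooth_deriv \<sigma> x" for x
    unfolding smooth_deriv_def
  proof (rule fconv_tendsto[OF _ _ _ cl'])
    fix n z
    have "\<bar>gauss_deriv (t n) z\<bar> \<le> (1 / t n + 2 * t n) / (t n)\<^sup>2" by (rule gauss_deriv_abs_le[OF t(3)])
    also have "\<dots> \<le> (1 / a + 2 * b) / a\<^sup>2" using t[of n] ab
      by (intro frac_le add_mono power_mono mult_left_mono) (auto simp: frac_le)
    finally show "\<bar>gauss_deriv (t n) z\<bar> \<le> (1 / a + 2 * b) / a\<^sup>2" .
  qed auto
  have "(\<lambda>n. smooth_fisher (t n)) \<longlonglongrightarrow> smooth_fisher \<sigma>"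
    unfolding smooth_fisher_def
  proof (rule integral_dominated_convergence[where w="fconv H p"])
    show "integrable lborel (fconv H p)" by (rule fconv_integrable(1)[OF Hi]) simp
    show "AE x in lborel. (\<lambda>i. (smooth_deriv (t i) x)\<^sup>2 / smooth (t i) x) \<longlonglongrightarrow> (smooth_deriv \<sigma> x)\<^sup>2 / smooth \<sigma> x"
      using smooth_pos[OF s0] by (intro AE_I2 tendsto_intros wl wl') (auto simp: less_le)
    show "AE x in lborel. norm ((smooth_deriv (t i) x)\<^sup>2 / smooth (t i) x) \<le> fconv H p x" for i
    proof (rule AE_I2)
      fix x
      have "(smooth_deriv (t i) x)\<^sup>2 / smooth (t i) x \<le> fconv (gauss_info (t i)) p x"
        by (rule smooth_deriv_sq_le[OF t(3)])
      also have "\<dots> \<le> fconv H p x"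
        unfolding fconv_def
      proof (rule integral_mono)
        show "integrable lborel (\<lambda>y. gauss_info (t i) (x - y) * p y)"
          by (rule fconv_integrand_integrable[OF _ gauss_info_le[OF t(3)]]) auto
        show "integrable lborel (\<lambda>y. H (x - y) * p y)"
          by (rule fconv_integrand_integrable[OF _ Hb]) auto
      qed (auto intro!: mult_right_mono dom nonneg)
      finally show "norm ((smooth_deriv (t i) x)\<^sup>2 / smooth (t i) x) \<le> fconv H p x"
        using smooth_pos[OF t(3)[of i], of x] by simp
    qed
  qed measurable
  then show "(\<lambda>n. smooth_fisher (s n)) \<longlonglongrightarrow> smooth_fisher \<sigma>"
    unfolding t_def by (rule LIMSEQ_offset)
qed

text \<open>The integral of \<open>(x - \<mu>) w'(x)\<close> for the smoothed density \<open>w\<close> is \<open>-1\<close> and the variance under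
  \<open>w\<close> is \<open>\<sigma>\<^sup>2 + (\<nu> - \<mu>\<^sup>2)\<close>; Cauchy-Schwarz finishes.\<close>

lemma Cramer_Rao:
  assumes s: "\<sigma> > 0"
    and m1: "has_bochner_integral lborel (\<lambda>y. y * p y) \<mu>"
    and m2: "has_bochner_integral lborel (\<lambda>y. y\<^sup>2 * p y) \<nu>"
  shows "1 \<le> (\<sigma>\<^sup>2 + (\<nu> - \<mu>\<^sup>2)) * smooth_fisher \<sigma>"
proof -
  define g1 where "g1 y = (y - \<mu>) * p y" for y
  define g2 where "g2 y = (y - \<mu>)\<^sup>2 * p y" for y
  have g1: "has_bochner_integral lborel g1 0"
    using has_bochner_integral_diff[OF m1 has_bochner_integral_mult_right[OF density, of \<mu>]]
    by (simp add: g1_def[abs_def] left_diff_distrib)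
  have g2: "has_bochner_integral lborel g2 (\<nu> - \<mu>\<^sup>2)"
    using has_bochner_integral_add[OF has_bochner_integral_diff[OF m2 has_bochner_integral_mult_right[OF m1, of "2 * \<mu>"]]
        has_bochner_integral_mult_right[OF density, of "\<mu>\<^sup>2"]]
    by (simp add: g2_def[abs_def] power2_diff algebra_simps power2_eq_square)
  have gi: "integrable lborel g1" "integrable lborel g2" using g1 g2 by (auto simp: has_bochner_integral_iff)
  define k1 where "k1 z = z * normal_density 0 \<sigma> z" for z
  define k2 where "k2 z = z\<^sup>2 * normal_density 0 \<sigma> z" for z
  define k3 where "k3 z = z * gauss_deriv \<sigma> z" for z
  have km[measurable]: "k1 \<in> borel_measurable borel" "k2 \<in> borel_measurable borel" "k3 \<in> borel_measurable borel"
    unfolding k1_def[abs_def] k2_def[abs_def] k3_def[abs_def] by measurable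
  have b1: "\<bar>k1 z\<bar> \<le> 1 / \<sigma> + 2 * \<sigma>" for z
    using gauss_abs_le[OF s, of z] by (simp add: k1_def abs_mult)
  have b2: "\<bar>k2 z\<bar> \<le> 2 * \<sigma>" for z
    using gauss_sq_le[OF s, of z] by (simp add: k2_def abs_mult)
  have b3: "\<bar>k3 z\<bar> \<le> 2 * \<sigma> / \<sigma>\<^sup>2" for z
  proof -
    have "\<bar>k3 z\<bar> = k2 z / \<sigma>\<^sup>2"
      by (simp add: k3_def k2_def gauss_deriv_def abs_mult power2_eq_square)
    then show ?thesis using b2[of z] by (simp add: divide_right_mono)
  qed
  note I = fconv_integrand_integrable
  have hx: "(x - \<mu>) * smooth_deriv \<sigma> x = fconv k3 p x + fconv (gauss_deriv \<sigma>) g1 x" for x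
  proof -
    have "(x - \<mu>) * smooth_deriv \<sigma> x = (\<integral>y. k3 (x - y) * p y + gauss_deriv \<sigma> (x - y) * g1 y \<partial>lborel)"
      unfolding smooth_deriv_def fconv_def
      by (subst Bochner_Integration.integral_mult_right_zero[symmetric], intro Bochner_Integration.integral_cong)
         (auto simp: k3_def g1_def algebra_simps)
    also have "\<dots> = fconv k3 p x + fconv (gauss_deriv \<sigma>) g1 x"
      unfolding fconv_def
      by (intro Bochner_Integration.integral_add I[OF _ b3] I[OF _ gauss_deriv_abs_le[OF s]] gi) auto
    finally show ?thesis .
  qed
  have kx: "(x - \<mu>)\<^sup>2 * smooth \<sigma> x = fconv k2 p x + 2 * fconv k1 g1 x + fconv (normal_density 0 \<sigma>) g2 x" for x
  proof -
    have "(x - \<mu>)\<^sup>2 * smooth \<sigma> x =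
      (\<integral>y. k2 (x - y) * p y + 2 * (k1 (x - y) * g1 y) + normal_density 0 \<sigma> (x - y) * g2 y \<partial>lborel)"
      unfolding smooth_def fconv_def
      by (subst Bochner_Integration.integral_mult_right_zero[symmetric], intro Bochner_Integration.integral_cong)
         (auto simp: k2_def k1_def g1_def g2_def algebra_simps power2_eq_square)
    also have "\<dots> = fconv k2 p x + 2 * fconv k1 g1 x + fconv (normal_density 0 \<sigma>) g2 x"
    proof -
      have "integrable lborel (\<lambda>y. k2 (x - y) * p y)" "integrable lborel (\<lambda>y. k1 (x - y) * g1 y)"
        "integrable lborel (\<lambda>y. normal_density 0 \<sigma> (x - y) * g2 y)"
        by (auto intro!: I[OF _ b1] I[OF _ b2] I[OF _ gauss_norm_le[OF s]] gi)
      then show ?thesis unfolding fconv_def by simp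
    qed
    finally show ?thesis .
  qed
  note C = fconv_integrable[OF _ p_integrable] fconv_integrable[OF _ gi(1)] fconv_integrable[OF _ gi(2)]
  have Gi: "integrable lborel k1" "integrable lborel k2" "integrable lborel k3"
    "integrable lborel (normal_density 0 \<sigma>)" "integrable lborel (gauss_deriv \<sigma>)"
    and Gv: "(\<integral>z. k2 z \<partial>lborel) = \<sigma>\<^sup>2" "(\<integral>z. k3 z \<partial>lborel) = -1" "(\<integral>z. normal_density 0 \<sigma> z \<partial>lborel) = 1"
    using gauss_integrals[OF s] gauss_z_deriv_integral[OF s] gauss_deriv_integral[OF s]
    unfolding k1_def[abs_def] k2_def[abs_def] k3_def[abs_def] by (auto simp: has_bochner_integral_iff)
  have pv: "(\<integral>y. p y \<partial>lborel) = 1" "(\<integral>y. g1 y \<partial>lborel) = 0" "(\<integral>y. g2 y \<partial>lborel) = \<nu> - \<mu>\<^sup>2"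
    using density g1 g2 by (auto simp: has_bochner_integral_iff)
  have h: "integrable lborel (\<lambda>x. (x - \<mu>) * smooth_deriv \<sigma> x)"
    "(\<integral>x. (x - \<mu>) * smooth_deriv \<sigma> x \<partial>lborel) = -1"
    unfolding hx using C Gi Gv pv by simp_all
  have k: "integrable lborel (\<lambda>x. (x - \<mu>)\<^sup>2 * smooth \<sigma> x)"
    "(\<integral>x. (x - \<mu>)\<^sup>2 * smooth \<sigma> x \<partial>lborel) = \<sigma>\<^sup>2 + (\<nu> - \<mu>\<^sup>2)"
    unfolding kx using C Gi Gv pv by simp_all
  have "(\<integral>x. (x - \<mu>) * smooth_deriv \<sigma> x \<partial>lborel)\<^sup>2 \<le>
     (\<integral>x. (x - \<mu>)\<^sup>2 * smooth \<sigma> x \<partial>lborel) * (\<integral>x. (smooth_deriv \<sigma> x)\<^sup>2 / smooth \<sigma> x \<partial>lborel)"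
    using smooth_pos[OF s]
    by (intro Cauchy_Schwarz_pointwise h k smooth_fisher_integrable[OF s])
       (auto simp: power_mult_distrib less_imp_le less_imp_neq[symmetric])
  then show ?thesis unfolding h k smooth_fisher_def[symmetric] by simp
qed

text \<open>A zero of a nonnegative function is a minimum. So \<open>d\<^sup>2 / p\<close> with the convention
  \<open>x / 0 = 0\<close> loses nothing where the density vanishes.\<close>

lemma DERIV_eq_0_at_root:
  assumes "(p has_real_derivative d) (at y)" "p y = 0" shows "d = 0"
  using DERIV_local_min[OF assms(1), of 1] nonneg assms(2) by auto

text \<open>By integration by parts the derivative of the smoothed density is both the convolution with the
  derivative of the Gaussian and the convolution with the derivative of \<open>p\<close>, hence also
  \<open>a\<close> times the first plus \<open>b\<close> times the second. Cauchy-Schwarz in \<open>y\<close> and integration over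
  \<open>x\<close> give the bound, since the cross term carries the factor \<open>\<integral> \<phi>' = 0\<close>. Optimising
  over \<open>a\<close> yields Stam's inequality \<open>I \<le> J / (1 + \<sigma>\<^sup>2 J)\<close>.\<close>

lemma Stam:
  assumes s: "\<sigma> > 0" and der: "\<And>y. (p has_real_derivative d y) (at y)"
    and [measurable]: "d \<in> borel_measurable borel"
    and J: "has_bochner_integral lborel (\<lambda>y. (d y)\<^sup>2 / p y) J" and ab: "a + b = 1"
  shows "smooth_fisher \<sigma> \<le> a\<^sup>2 / \<sigma>\<^sup>2 + b\<^sup>2 * J"
proof -
  define e where "e y = (d y)\<^sup>2 / p y" for y
  have e: "integrable lborel e" "(\<integral>y. e y \<partial>lborel) = J" using J by (auto simp: e_def[abs_def] has_bochner_integral_iff)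
  have d0: "d y = 0" if "p y = 0" for y using DERIV_eq_0_at_root[OF der that] .
  have dpe: "(d y)\<^sup>2 = p y * e y" for y using d0[of y] by (simp add: e_def)
  have e0: "0 \<le> e y" for y by (simp add: e_def nonneg)
  have d: "integrable lborel d"
  proof (rule Bochner_Integration.integrable_bound[of _ "\<lambda>y. (p y + e y) / 2"])
    show "integrable lborel (\<lambda>y. (p y + e y) / 2)" using e by simp
    show "AE y in lborel. norm (d y) \<le> norm ((p y + e y) / 2)"
    proof (rule AE_I2)
      fix y
      have "\<bar>d y\<bar> \<le> sqrt (p y * e y)" by (intro real_le_rsqrt) (simp add: dpe)
      also have "\<dots> \<le> (p y + e y) / 2" by (rule arith_geo_mean_sqrt) (auto simp: nonneg e0)
      finally show "norm (d y) \<le> norm ((p y + e y) / 2)" by simp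
    qed
  qed measurable
  note [measurable] = borel_measurable_integrable[OF e(1), simplified]
  note I = fconv_integrand_integrable
  note bd = gauss_norm_le[OF s] gauss_deriv_abs_le[OF s] gauss_info_le[OF s]
  define q where "q x = a\<^sup>2 * fconv (gauss_info \<sigma>) p x + 2 * a * b * fconv (gauss_deriv \<sigma>) d x
      + b\<^sup>2 * fconv (normal_density 0 \<sigma>) e x" for x
  have le: "(smooth_deriv \<sigma> x)\<^sup>2 / smooth \<sigma> x \<le> q x" for x
  proof -
    define h where "h y = a * (gauss_deriv \<sigma> (x - y) * p y) + b * (normal_density 0 \<sigma> (x - y) * d y)" for y
    define r where "r y = a\<^sup>2 * (gauss_info \<sigma> (x - y) * p y) + 2 * a * b * (gauss_deriv \<sigma> (x - y) * d y)
       + b\<^sup>2 * (normal_density 0 \<sigma> (x - y) * e y)" for y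
    have ii: "integrable lborel (\<lambda>y. gauss_deriv \<sigma> (x - y) * p y)" "integrable lborel (\<lambda>y. normal_density 0 \<sigma> (x - y) * d y)"
      "integrable lborel (\<lambda>y. gauss_info \<sigma> (x - y) * p y)" "integrable lborel (\<lambda>y. gauss_deriv \<sigma> (x - y) * d y)"
      "integrable lborel (\<lambda>y. normal_density 0 \<sigma> (x - y) * e y)" "integrable lborel (\<lambda>y. normal_density 0 \<sigma> (x - y) * p y)"
      by (auto intro!: I[OF _ bd(1)] I[OF _ bd(2)] I[OF _ bd(3)] d e)
    have swap: "fconv (normal_density 0 \<sigma>) d x = smooth_deriv \<sigma> x"
      unfolding smooth_deriv_def
      by (rule fconv_derivative_swap[symmetric, OF DERIV_gauss[OF s] der _ bd(1) bd(2) p_integrable d]) auto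
    have hI: "(\<integral>y. h y \<partial>lborel) = a * smooth_deriv \<sigma> x + b * fconv (normal_density 0 \<sigma>) d x"
      unfolding h_def smooth_deriv_def fconv_def using ii by simp
    have hI': "(\<integral>y. h y \<partial>lborel) = smooth_deriv \<sigma> x"
      unfolding hI swap distrib_right[symmetric] ab by simp
    have rI: "(\<integral>y. r y \<partial>lborel) = q x"
      unfolding r_def q_def fconv_def using ii by simp
    have wI: "(\<integral>y. normal_density 0 \<sigma> (x - y) * p y \<partial>lborel) = smooth \<sigma> x"
      by (simp add: smooth_def fconv_def)
    have hr: "(h y)\<^sup>2 = normal_density 0 \<sigma> (x - y) * p y * r y" for y
    proof -
      have "(h y)\<^sup>2 = (normal_density 0 \<sigma> (x - y))\<^sup>2 *
        (a\<^sup>2 * ((x - y) / \<sigma>\<^sup>2)\<^sup>2 * (p y)\<^sup>2 - 2 * a * b * ((x - y) / \<sigma>\<^sup>2) * p y * d y + b\<^sup>2 * (d y)\<^sup>2)"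
        unfolding h_def gauss_deriv_def by (simp add: power2_eq_square algebra_simps)
      also have "\<dots> = normal_density 0 \<sigma> (x - y) * p y * r y"
        unfolding dpe r_def gauss_info_def gauss_deriv_def by (simp add: power2_eq_square algebra_simps)
      finally show ?thesis .
    qed
    have r0: "0 \<le> r y" for y
    proof (cases "p y = 0")
      case True then show ?thesis using d0[OF True] by (simp add: r_def e_def)
    next
      case False
      then have "0 < normal_density 0 \<sigma> (x - y) * p y"
        using nonneg[of y] normal_density_pos[OF s] by (auto simp: less_le)
      moreover have "0 \<le> normal_density 0 \<sigma> (x - y) * p y * r y" unfolding hr[symmetric] by simp
      ultimately show ?thesis by (simp add: zero_le_mult_iff)
    qed
    have "(\<integral>y. h y \<partial>lborel)\<^sup>2 \<le> (\<integral>y. normal_density 0 \<sigma> (x - y) * p y \<partial>lborel) * (\<integral>y. r y \<partial>lborel)"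
    proof (rule Cauchy_Schwarz_pointwise)
      show "integrable lborel h" "integrable lborel r" unfolding h_def[abs_def] r_def[abs_def] using ii by auto
    qed (use ii in \<open>auto simp: nonneg r0 hr\<close>)
    then show ?thesis unfolding hI' rI wI using smooth_pos[OF s, of x]
      by (simp add: pos_divide_le_eq mult.commute)
  qed
  have Gi: "integrable lborel (gauss_info \<sigma>)" "integrable lborel (gauss_deriv \<sigma>)" "integrable lborel (normal_density 0 \<sigma>)"
    and Gv: "(\<integral>z. gauss_info \<sigma> z \<partial>lborel) = 1 / \<sigma>\<^sup>2" "(\<integral>z. gauss_deriv \<sigma> z \<partial>lborel) = 0"
      "(\<integral>z. normal_density 0 \<sigma> z \<partial>lborel) = 1"
    using gauss_info_integral[OF s] gauss_deriv_integral[OF s] gauss_integrals(1)[OF s]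
    by (auto simp: has_bochner_integral_iff)
  have pv: "(\<integral>y. p y \<partial>lborel) = 1" using density by (simp add: has_bochner_integral_iff)
  note C = fconv_integrable[OF _ p_integrable] fconv_integrable[OF _ d] fconv_integrable[OF _ e(1)]
  have "smooth_fisher \<sigma> \<le> (\<integral>x. q x \<partial>lborel)"
    unfolding smooth_fisher_def
  proof (rule integral_mono[OF smooth_fisher_integrable[OF s] _ le])
    show "integrable lborel q" unfolding q_def[abs_def] using C Gi by simp
  qed
  also have "\<dots> = a\<^sup>2 / \<sigma>\<^sup>2 + b\<^sup>2 * J"
    unfolding q_def using C Gi Gv pv e by simp
  finally show ?thesis .
qed

end

section \<open>Fisher information of a random variable and of its Gaussian perturbation\<close>

text \<open>Two such densities agree almost everywhere, and the open set on which two continuous functions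
  differ is empty as soon as it is negligible.\<close>

lemma diff_density_unique:
  assumes "is_diff_density M H p" "is_diff_density M H q" shows "p = q"
proof -
  have pc: "continuous_on UNIV p" "continuous_on UNIV q"
    using assms unfolding is_diff_density_def
    by (auto intro!: continuous_at_imp_continuous_on differentiable_imp_continuous_within)
  have [measurable]: "p \<in> borel_measurable borel" "q \<in> borel_measurable borel"
    using pc by (auto intro: borel_measurable_continuous_onI)
  have "AE x in lborel. ennreal (p x) = ennreal (q x)"
    using assms unfolding is_diff_density_def
    by (intro sigma_finite_measure.density_unique[OF lborel.sigma_finite_measure_axioms])
       (auto dest!: distributed_distr_eq_density)
  then have ae: "AE x in lborel. p x = q x"
    by eventually_elim (use assms in \<open>auto simp: is_diff_density_def\<close>)
  have "open {x. p x \<noteq> q x}"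
    using pc by (auto intro!: open_Collect_neq)
  moreover have "{x. p x \<noteq> q x} \<in> null_sets lborel"
    using ae by (subst (asm) AE_iff_null) auto
  then have "negligible {x. p x \<noteq> q x}"
    by (simp add: negligible_iff_null_sets null_sets_completionI)
  ultimately have "{x. p x \<noteq> q x} = {}"
    using open_not_negligible by blast
  then show ?thesis by auto
qed

lemma diff_density_eq: "is_diff_density M H p \<Longrightarrow> diff_density M H = p"
  unfolding diff_density_def using diff_density_unique by (blast intro: the_equality)

text \<open>The derivative is a pointwise limit of difference quotients.\<close>

lemma borel_measurable_DERIV:
  fixes p d :: "real \<Rightarrow> real"
  assumes der: "\<And>y. (p has_real_derivative d y) (at y)" shows "d \<in> borel_measurable borel"
proof -
  have [measurable]: "p \<in> borel_measurable borel"
    by (intro borel_measurable_continuous_onI) (meson DERIV_isCont continuous_at_imp_continuous_on der)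
  show ?thesis
  proof (rule borel_measurable_LIMSEQ_real)
    fix y
    have "(\<lambda>n. (p (y + inverse (real (Suc n))) - p y) / inverse (real (Suc n))) \<longlonglongrightarrow> d y"
      using der[of y] LIMSEQ_inverse_real_of_nat
      unfolding DERIV_def tendsto_at_iff_sequentially comp_def by auto
    then show "(\<lambda>n. (p (y + inverse (real (Suc n))) - p y) / inverse (real (Suc n))) \<longlonglongrightarrow> d y" .
  qed measurable
qed

lemma fisher_info_eq:
  assumes p: "is_diff_density M H p" and der: "\<And>y. (p has_real_derivative d y) (at y)"
  shows "fisher_info M H = (\<integral>\<^sup>+x. ennreal ((d x)\<^sup>2 / p x) \<partial>lborel)"
proof -
  note [measurable] = borel_measurable_DERIV[OF der]
  have D: "distributed M lborel H (\<lambda>x. ennreal (p x))" and p0: "\<And>x. 0 \<le> p x"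
    using p by (auto simp: is_diff_density_def)
  have [measurable]: "p \<in> borel_measurable borel"
    by (intro borel_measurable_continuous_onI) (meson DERIV_isCont continuous_at_imp_continuous_on der)
  have dd: "deriv p = d" using der DERIV_imp_deriv by blast
  have "fisher_info M H = (\<integral>\<^sup>+\<omega>. ennreal ((d (H \<omega>) / p (H \<omega>))\<^sup>2) \<partial>M)"
    unfolding fisher_info_def diff_density_eq[OF p] dd ..
  also have "\<dots> = (\<integral>\<^sup>+x. ennreal (p x) * ennreal ((d x / p x)\<^sup>2) \<partial>lborel)"
    by (subst distributed_nn_integral[OF D]) auto
  also have "\<dots> = (\<integral>\<^sup>+x. ennreal ((d x)\<^sup>2 / p x) \<partial>lborel)"
    by (intro nn_integral_cong) (auto simp: ennreal_mult'[symmetric] p0 power2_eq_square)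
  finally show ?thesis .
qed

lemma (in prob_space) is_diff_density_real_density:
  assumes "is_diff_density M H p" shows "real_density p"
proof
  have D: "distributed M lborel H (\<lambda>x. ennreal (p x))" and p0: "\<And>x. 0 \<le> p x" and c: "continuous_on UNIV p"
    using assms by (auto simp: is_diff_density_def
        intro!: continuous_at_imp_continuous_on differentiable_imp_continuous_within)
  have [measurable]: "p \<in> borel_measurable borel" using c by (rule borel_measurable_continuous_onI)
  have "(\<integral>\<^sup>+x. ennreal (p x) \<partial>lborel) = (\<integral>\<^sup>+x. ennreal (p x) * 1 \<partial>lborel)" by simp
  also have "\<dots> = (\<integral>\<^sup>+\<omega>. 1 \<partial>M)"
    by (rule distributed_nn_integral[OF D]) simp
  also have "\<dots> = ennreal 1" by (simp add: emeasure_space_1)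
  finally show "has_bochner_integral lborel p 1"
    by (intro has_bochner_integral_nn_integral) (auto simp: p0)
  show "0 \<le> p y" for y by fact
qed

lemma (in prob_space) smoothed_fisher_info:
  assumes G: "distributed M lborel G (\<lambda>x. ennreal (std_normal_density x))"
    and V: "is_diff_density M V p" and indep: "indep_var borel G borel V" and s: "\<sigma> > 0"
  shows "fisher_info M (\<lambda>\<omega>. \<sigma> * G \<omega> + V \<omega>) = ennreal (real_density.smooth_fisher p \<sigma>)"
proof -
  interpret real_density p by (rule is_diff_density_real_density[OF V])
  have GN: "distributed M lborel (\<lambda>\<omega>. \<sigma> * G \<omega>) (\<lambda>x. ennreal (normal_density 0 \<sigma> x))"
    using normal_density_affine[of G 0 1 \<sigma> 0] G s by simp
  have VD: "distributed M lborel V (\<lambda>x. ennreal (p x))" using V by (simp add: is_diff_density_def)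
  have "indep_var borel ((\<lambda>x. \<sigma> * x) \<circ> G) borel (id \<circ> V)"
    by (rule indep_var_compose[OF indep]) auto
  then have ind: "indep_var borel (\<lambda>\<omega>. \<sigma> * G \<omega>) borel V" by (simp add: comp_def)
  have eq: "(\<integral>\<^sup>+y. ennreal (normal_density 0 \<sigma> (x - y)) * ennreal (p y) \<partial>lborel) = ennreal (smooth \<sigma> x)" for x
    unfolding smooth_def fconv_def
    by (subst nn_integral_eq_integral[symmetric])
       (auto simp: ennreal_mult' nonneg intro!: fconv_integrand_integrable[OF _ gauss_norm_le[OF s]])
  have "distributed M lborel (\<lambda>\<omega>. \<sigma> * G \<omega> + V \<omega>) (\<lambda>x. ennreal (smooth \<sigma> x))"
    using distributed_convolution[OF ind GN VD] by (simp add: eq)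
  then have "is_diff_density M (\<lambda>\<omega>. \<sigma> * G \<omega> + V \<omega>) (smooth \<sigma>)"
    unfolding is_diff_density_def using smooth_pos[OF s] DERIV_smooth[OF s]
    by (auto simp: less_imp_le real_differentiable_def)
  from fisher_info_eq[OF this DERIV_smooth[OF s]]
  show ?thesis unfolding smooth_fisher_def
    using smooth_fisher_integrable[OF s] smooth_pos[OF s]
    by (subst (asm) nn_integral_eq_integral) (auto simp: less_imp_le)
qed

section \<open>The equation for the optimal noise level\<close>

text \<open>The map \<open>\<kappa>\<close> with the Fisher information as an arbitrary function \<open>I\<close>, which separates the
  real analysis of the equation \<open>\<kappa>(\<sigma>) = 1 / \<delta>\<close> from probability.\<close>

definition kappa_of :: "(real \<Rightarrow> real) \<Rightarrow> real \<Rightarrow> real" where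
  "kappa_of I \<sigma> = (if \<sigma> = 0 then 0
     else \<sigma>\<^sup>2 * (\<sigma>\<^sup>2 * I \<sigma> + I \<sigma> - 1) / (1 + \<sigma>\<^sup>2 * (\<sigma>\<^sup>2 * I \<sigma> - 1)))"

lemma kappa_denominator_pos:
  fixes \<sigma> I v :: real
  assumes "\<sigma> > 0" "1 \<le> (\<sigma>\<^sup>2 + v) * I" "0 < v" "v \<le> 1"
  shows "0 < 1 + \<sigma>\<^sup>2 * (\<sigma>\<^sup>2 * I - 1)"
proof -
  have "0 < \<sigma>\<^sup>2 * (1 - v) + v" using assms by (simp add: add_nonneg_pos)
  also have "\<dots> = (1 - \<sigma>\<^sup>2) * (\<sigma>\<^sup>2 + v) + \<sigma>\<^sup>2 * \<sigma>\<^sup>2 * 1" by (simp add: algebra_simps)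
  also have "\<dots> \<le> (1 - \<sigma>\<^sup>2) * (\<sigma>\<^sup>2 + v) + \<sigma>\<^sup>2 * \<sigma>\<^sup>2 * ((\<sigma>\<^sup>2 + v) * I)"
    using assms(2) by (intro add_left_mono mult_left_mono) auto
  also have "\<dots> = (1 + \<sigma>\<^sup>2 * (\<sigma>\<^sup>2 * I - 1)) * (\<sigma>\<^sup>2 + v)" by (simp add: algebra_simps)
  finally show ?thesis by (rule zero_less_mult_pos2) (use assms in \<open>simp add: add_pos_pos\<close>)
qed

text \<open>\<open>\<kappa>\<close> increases with the Fisher information, and the bound is its value at the smallest
  information \<open>1 / (\<sigma>\<^sup>2 + v)\<close> that the Cramer-Rao inequality permits, that of a Gaussian with
  the same variance. It equals \<open>1 / \<delta>\<close> exactly at \<open>\<sigma> = \<sigma>\<^sub>L\<^sub>S\<close>.\<close>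

lemma kappa_lower:
  fixes \<sigma> v :: real
  assumes "\<sigma> > 0" "1 \<le> (\<sigma>\<^sup>2 + v) * I \<sigma>" "0 < v" "v \<le> 1"
  shows "\<sigma>\<^sup>2 * (1 - v) / (v + \<sigma>\<^sup>2 * (1 - v)) \<le> kappa_of I \<sigma>"
proof -
  note D = kappa_denominator_pos[OF assms]
  have "\<sigma>\<^sup>2 * (1 - v) * (1 + \<sigma>\<^sup>2 * (\<sigma>\<^sup>2 * I \<sigma> - 1)) + \<sigma>\<^sup>2 * ((\<sigma>\<^sup>2 + v) * I \<sigma> - 1)
      = \<sigma>\<^sup>2 * (\<sigma>\<^sup>2 * I \<sigma> + I \<sigma> - 1) * (v + \<sigma>\<^sup>2 * (1 - v))"
    by (simp add: algebra_simps)
  moreover have "0 \<le> \<sigma>\<^sup>2 * ((\<sigma>\<^sup>2 + v) * I \<sigma> - 1)" using assms by simp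
  ultimately have "\<sigma>\<^sup>2 * (1 - v) * (1 + \<sigma>\<^sup>2 * (\<sigma>\<^sup>2 * I \<sigma> - 1)) \<le> \<sigma>\<^sup>2 * (\<sigma>\<^sup>2 * I \<sigma> + I \<sigma> - 1) * (v + \<sigma>\<^sup>2 * (1 - v))"
    by linarith
  moreover have "0 < v + \<sigma>\<^sup>2 * (1 - v)" using assms by (simp add: add_pos_nonneg)
  ultimately show ?thesis
    using D assms(1) by (simp add: kappa_of_def frac_le_eq pos_divide_le_eq pos_le_divide_eq mult_ac)
qed

text \<open>The value of \<open>\<kappa>\<close> at the largest information \<open>J / (1 + \<sigma>\<^sup>2 J)\<close> that Stam's inequality permits.\<close>

lemma kappa_upper:
  fixes \<sigma> v J :: real
  assumes "\<sigma> > 0" "1 \<le> (\<sigma>\<^sup>2 + v) * I \<sigma>" "0 < v" "v \<le> 1" "1 < J" "(1 + \<sigma>\<^sup>2 * J) * I \<sigma> \<le> J"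
  shows "kappa_of I \<sigma> \<le> \<sigma>\<^sup>2 * (J - 1) / (1 + \<sigma>\<^sup>2 * (J - 1))"
proof -
  note D = kappa_denominator_pos[OF assms(1-4)]
  have "\<sigma>\<^sup>2 * (\<sigma>\<^sup>2 * I \<sigma> + I \<sigma> - 1) * (1 + \<sigma>\<^sup>2 * (J - 1)) + \<sigma>\<^sup>2 * (J - (1 + \<sigma>\<^sup>2 * J) * I \<sigma>)
      = \<sigma>\<^sup>2 * (J - 1) * (1 + \<sigma>\<^sup>2 * (\<sigma>\<^sup>2 * I \<sigma> - 1))"
    by (simp add: algebra_simps)
  moreover have "0 \<le> \<sigma>\<^sup>2 * (J - (1 + \<sigma>\<^sup>2 * J) * I \<sigma>)" using assms by simp
  ultimately have "\<sigma>\<^sup>2 * (\<sigma>\<^sup>2 * I \<sigma> + I \<sigma> - 1) * (1 + \<sigma>\<^sup>2 * (J - 1)) \<le> \<sigma>\<^sup>2 * (J - 1) * (1 + \<sigma>\<^sup>2 * (\<sigma>\<^sup>2 * I \<sigma> - 1))"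
    by linarith
  moreover have "0 < 1 + \<sigma>\<^sup>2 * (J - 1)" using assms by (simp add: add_pos_nonneg)
  ultimately show ?thesis
    using D assms(1) by (simp add: kappa_of_def pos_divide_le_eq pos_le_divide_eq mult_ac)
qed

text \<open>The upper bound on \<open>\<kappa>\<close> keeps every solution of \<open>\<kappa>(\<sigma>) = 1 / \<delta>\<close> above \<open>a\<close>, where it equals
  \<open>1 / \<delta>\<close>; the lower bound and continuity produce a solution not above the corresponding \<open>b\<close>.
  The solutions in \<open>[a, b]\<close> form a nonempty compact set, so the least one exists. The positivity
  of \<open>v\<close> and \<open>J > 1\<close> come out of comparing the two bounds on \<open>I\<close>, which give \<open>J v \<ge> 1\<close>.\<close>

lemma kappa_least_solution:
  fixes I :: "real \<Rightarrow> real" and v J \<delta> :: real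
  assumes cont: "\<And>\<sigma>. \<sigma> > 0 \<Longrightarrow> isCont I \<sigma>"
    and CR: "\<And>\<sigma>. \<sigma> > 0 \<Longrightarrow> 1 \<le> (\<sigma>\<^sup>2 + v) * I \<sigma>"
    and St: "\<And>\<sigma>. \<sigma> > 0 \<Longrightarrow> (1 + \<sigma>\<^sup>2 * J) * I \<sigma> \<le> J"
    and v: "v < 1" and J0: "0 \<le> J" and \<delta>: "\<delta> > 1"
  defines "\<sigma>\<^sub>0 \<equiv> (LEAST \<sigma>. 0 \<le> \<sigma> \<and> kappa_of I \<sigma> = 1 / \<delta>)"
  shows "0 < v" and "0 < \<sigma>\<^sub>0" and "\<sigma>\<^sub>0\<^sup>2 \<le> v / ((1 - v) * (\<delta> - 1))" and "1 / ((J - 1) * (\<delta> - 1)) \<le> \<sigma>\<^sub>0\<^sup>2" and "1 < J"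
proof -
  have Jv: "1 \<le> J * v"
  proof -
    have "(1 + 1 * J) * 1 \<le> (1 + 1 * J) * ((1 + v) * I 1)"
      using CR[of 1] J0 by (intro mult_left_mono) auto
    also have "\<dots> = ((1 + 1 * J) * I 1) * (1 + v)" by simp
    also have "\<dots> \<le> J * (1 + v)"
    proof (rule mult_right_mono)
      show "(1 + 1 * J) * I 1 \<le> J" using St[of 1] by simp
      have "0 \<le> 1 + v"
      proof (rule ccontr)
        assume n: "\<not> 0 \<le> 1 + v"
        define s where "s = sqrt (- v)"
        have "s > 0" "s\<^sup>2 = - v" using n by (auto simp: s_def)
        then show False using CR[of s] by simp
      qed
      then show "0 \<le> 1 + v" .
    qed
    finally show ?thesis by (simp add: algebra_simps)
  qed
  then have v0: "0 < v" using J0 by (metis less_le_trans mult_nonneg_nonpos2 mult.commute not_less zero_less_one)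
  then show "0 < v" .
  show J1: "1 < J"
  proof (rule ccontr)
    assume "\<not> 1 < J"
    then have "J * v \<le> 1 * v" using v0 by (intro mult_right_mono) auto
    then show False using Jv v by linarith
  qed
  define a where "a = sqrt (1 / ((J - 1) * (\<delta> - 1)))"
  define b where "b = sqrt (v / ((1 - v) * (\<delta> - 1)))"
  have a: "0 < a" "a\<^sup>2 = 1 / ((J - 1) * (\<delta> - 1))" using J1 \<delta> by (auto simp: a_def)
  have b: "0 < b" "b\<^sup>2 = v / ((1 - v) * (\<delta> - 1))" using v v0 \<delta> by (auto simp: b_def)
  have ab: "a \<le> b"
  proof -
    have "1 / (J - 1) \<le> v / (1 - v)" using J1 v Jv by (simp add: divide_simps algebra_simps)
    then have "1 / (J - 1) / (\<delta> - 1) \<le> v / (1 - v) / (\<delta> - 1)" using \<delta> by (intro divide_right_mono) auto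
    then show ?thesis unfolding a_def b_def by simp
  qed
  have sol_ge: "a \<le> s" if "s > 0" "1 / \<delta> \<le> kappa_of I s" for s
  proof -
    have "1 / \<delta> \<le> s\<^sup>2 * (J - 1) / (1 + s\<^sup>2 * (J - 1))"
      using that kappa_upper[of s v I J] CR St v v0 J1 by fastforce
    moreover have "0 < 1 + s\<^sup>2 * (J - 1)" using J1 by (simp add: add_pos_nonneg)
    ultimately have "1 + s\<^sup>2 * (J - 1) \<le> \<delta> * (s\<^sup>2 * (J - 1))"
      using \<delta> by (simp add: divide_simps mult.commute split: if_splits)
    then have "1 \<le> s\<^sup>2 * ((J - 1) * (\<delta> - 1))" by (simp add: algebra_simps)
    then have "1 / ((J - 1) * (\<delta> - 1)) \<le> s\<^sup>2"
      using J1 \<delta> by (simp add: pos_divide_le_eq)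
    then show ?thesis unfolding a_def using that by (intro real_le_lsqrt) auto
  qed
  have ka: "kappa_of I a \<le> 1 / \<delta>"
  proof -
    have "kappa_of I a \<le> a\<^sup>2 * (J - 1) / (1 + a\<^sup>2 * (J - 1))"
      by (rule kappa_upper[where v = v]) (use a(1) CR[OF a(1)] v0 J1 St[OF a(1)] v in simp_all)
    also have "a\<^sup>2 * (J - 1) = 1 / (\<delta> - 1)" using a J1 by simp
    also have "1 / (\<delta> - 1) / (1 + 1 / (\<delta> - 1)) = 1 / \<delta>" using \<delta> by (simp add: divide_simps)
    finally show ?thesis .
  qed
  have kb: "1 / \<delta> \<le> kappa_of I b"
  proof -
    have e: "b\<^sup>2 * (1 - v) = v / (\<delta> - 1)" using b v by simp
    have "1 / \<delta> = v / (\<delta> - 1) / (v + v / (\<delta> - 1))" using \<delta> v0 by (simp add: divide_simps algebra_simps)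
    also have "\<dots> \<le> kappa_of I b"
      unfolding e[symmetric]
      by (rule kappa_lower) (use b(1) CR[OF b(1)] v0 v in simp_all)
    finally show ?thesis .
  qed
  have kc: "continuous_on {a..b} (kappa_of I)"
  proof -
    have "continuous_on {a..b} I" using cont a by (auto intro!: continuous_at_imp_continuous_on)
    moreover have "1 + s\<^sup>2 * (s\<^sup>2 * I s - 1) \<noteq> 0" if "s \<in> {a..b}" for s
      using kappa_denominator_pos[of s v "I s"] CR[of s] v v0 a that by force
    ultimately have "continuous_on {a..b} (\<lambda>s. s\<^sup>2 * (s\<^sup>2 * I s + I s - 1) / (1 + s\<^sup>2 * (s\<^sup>2 * I s - 1)))"
      by (intro continuous_intros) auto
    then show ?thesis
      by (rule continuous_on_eq) (use a in \<open>auto simp: kappa_of_def\<close>)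
  qed
  define A where "A = {s \<in> {a..b}. kappa_of I s = 1 / \<delta>}"
  have "A \<noteq> {}" using IVT'[of "kappa_of I" a "1/\<delta>" b] ka kb ab kc by (auto simp: A_def)
  moreover have "compact A"
    unfolding A_def compact_eq_bounded_closed
    using bounded_subset[OF bounded_closed_interval[of a b]] continuous_closed_preimage_constant[OF kc]
    by (auto simp: subset_iff)
  ultimately obtain m where m: "m \<in> A" "\<And>s. s \<in> A \<Longrightarrow> m \<le> s"
    using compact_attains_inf by metis
  have "\<sigma>\<^sub>0 = m"
    unfolding \<sigma>\<^sub>0_def
  proof (rule Least_equality)
    show "0 \<le> m \<and> kappa_of I m = 1 / \<delta>" using m a by (auto simp: A_def)
    fix s assume s: "0 \<le> s \<and> kappa_of I s = 1 / \<delta>"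
    then have "s \<noteq> 0" using \<delta> by (auto simp: kappa_of_def)
    then have "a \<le> s" using sol_ge s by auto
    then show "m \<le> s" using m(2)[of s] m(1) s by (cases "s \<le> b") (auto simp: A_def)
  qed
  then have "a \<le> \<sigma>\<^sub>0" "\<sigma>\<^sub>0 \<le> b" using m by (auto simp: A_def)
  then show "0 < \<sigma>\<^sub>0" "\<sigma>\<^sub>0\<^sup>2 \<le> v / ((1 - v) * (\<delta> - 1))" "1 / ((J - 1) * (\<delta> - 1)) \<le> \<sigma>\<^sub>0\<^sup>2"
    unfolding a(2)[symmetric] b(2)[symmetric] using a(1) by (auto intro: power_mono)
qed

section \<open>The two ratio bounds\<close>

text \<open>Every event of the product \<open>S Y\<close> is an event of the pair.\<close>

lemma (in prob_space) indep_rv_imp_indep_var: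
  assumes "indep_rv M borel G (borel \<Otimes>\<^sub>M borel) (\<lambda>\<omega>. (S \<omega>, Y \<omega>))"
  shows "indep_var borel G borel (\<lambda>\<omega>. S \<omega> * Y \<omega> :: real)"
proof -
  let ?A = "{G -` E \<inter> space M | E. E \<in> sets borel}"
  let ?B = "{(\<lambda>\<omega>. S \<omega> * Y \<omega>) -` E \<inter> space M | E. E \<in> sets borel}"
  let ?C = "{(\<lambda>\<omega>. (S \<omega>, Y \<omega>)) -` E \<inter> space M | E. E \<in> sets (borel \<Otimes>\<^sub>M borel)}"
  have m: "G \<in> M \<rightarrow>\<^sub>M borel" "(\<lambda>\<omega>. (S \<omega>, Y \<omega>)) \<in> M \<rightarrow>\<^sub>M borel \<Otimes>\<^sub>M borel"
    and ind: "indep_set ?A ?C"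
    using assms by (auto simp: indep_rv_def)
  have mV: "(\<lambda>\<omega>. S \<omega> * Y \<omega>) \<in> M \<rightarrow>\<^sub>M borel"
    using measurable_compose[OF m(2), of "\<lambda>z. fst z * snd z" borel] by simp
  have "?B \<subseteq> ?C"
  proof safe
    fix E :: "real set" assume E: "E \<in> sets borel"
    have "(\<lambda>z. fst z * snd z :: real) -` E \<inter> space (borel \<Otimes>\<^sub>M borel) \<in> sets (borel \<Otimes>\<^sub>M borel)"
      by (rule measurable_sets[OF _ E]) measurable
    then have "(\<lambda>z. fst z * snd z) -` E \<in> sets (borel \<Otimes>\<^sub>M borel)" by (simp add: space_pair_measure)
    then show "\<exists>F. (\<lambda>\<omega>. S \<omega> * Y \<omega>) -` E \<inter> space M = (\<lambda>\<omega>. (S \<omega>, Y \<omega>)) -` F \<inter> space M \<and>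
        F \<in> sets (borel \<Otimes>\<^sub>M borel)"
      by (intro exI[of _ "(\<lambda>z. fst z * snd z) -` E"]) auto
  qed
  then have "indep_set ?A ?B"
    unfolding indep_set_def
    by (intro indep_sets_mono_sets[OF ind[unfolded indep_set_def]]) (simp split: bool.split)
  moreover have "Int_stable {H -` E \<inter> space M | E. E \<in> sets borel}" for H :: "'a \<Rightarrow> real"
  proof (rule Int_stableI)
    fix a b assume "a \<in> {H -` E \<inter> space M | E. E \<in> sets borel}" "b \<in> {H -` E \<inter> space M | E. E \<in> sets borel}"
    then obtain E F where "a = H -` E \<inter> space M" "b = H -` F \<inter> space M" "E \<in> sets borel" "F \<in> sets borel" by auto
    then show "a \<inter> b \<in> {H -` E \<inter> space M | E. E \<in> sets borel}" by (auto intro!: exI[of _ "E \<inter> F"])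
  qed
  ultimately show ?thesis
    unfolding indep_var_eq using m(1) mV by (auto intro!: indep_set_sigma_sets)
qed

lemma (in prob_space) diff_density_integral:
  assumes p: "is_diff_density M V p" and g: "g \<in> borel_measurable borel"
    and i: "has_bochner_integral M (\<lambda>\<omega>. g (V \<omega>)) c"
  shows "has_bochner_integral lborel (\<lambda>y. g y * p y) (c::real)"
proof -
  have D: "distributed M lborel V (\<lambda>x. ennreal (p x))" and p0: "\<And>x. 0 \<le> p x"
    using p by (auto simp: is_diff_density_def)
  show ?thesis
    using distributed_integrable[OF D, of g] distributed_integral[OF D, of g] g i p0
    by (auto simp: has_bochner_integral_iff mult.commute)
qed

text \<open>The case of finite Fisher information \<open>J\<close>. The lower bound \<open>\<sigma>\<^sub>o\<^sub>p\<^sub>t\<^sup>2 \<ge> 1 / ((J - 1) (\<delta> - 1))\<close> is the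
  first claim. For the correlations, \<open>1 + \<sigma>\<^sub>L\<^sub>S\<^sup>2 \<le> \<xi> (1 + \<sigma>\<^sub>o\<^sub>p\<^sub>t\<^sup>2)\<close> needs \<open>\<xi> \<ge> 1\<close> besides, which follows from
  \<open>\<sigma>\<^sub>o\<^sub>p\<^sub>t \<le> \<sigma>\<^sub>L\<^sub>S\<close>.\<close>

lemma (in prob_space) ratio_bounds:
  fixes S Y G :: "'a \<Rightarrow> real" and \<delta> J :: real
  defines "V \<equiv> \<lambda>\<omega>. S \<omega> * Y \<omega>" and "\<mu> \<equiv> mean_SY M S Y"
  defines "\<xi> \<equiv> (J - 1) * ((1 - \<mu>\<^sup>2) / \<mu>\<^sup>2)"
  assumes G: "distributed M lborel G (\<lambda>x. ennreal (std_normal_density x))"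
    and ind: "indep_var borel G borel V" and V2: "has_bochner_integral M (\<lambda>\<omega>. (V \<omega>)\<^sup>2) 1"
    and p: "is_diff_density M V p" and der: "\<And>y. (p has_real_derivative d y) (at y)"
    and J: "has_bochner_integral lborel (\<lambda>y. (d y)\<^sup>2 / p y) J"
    and \<mu>: "\<mu> > 0" and \<delta>: "\<delta> > 1"
  shows "(sigma_LS M S Y \<delta>)\<^sup>2 / (sigma_opt M S Y G \<delta>)\<^sup>2 \<le> \<xi>"
    and "corr_opt M S Y G \<delta> / corr_LS M S Y \<delta> \<le> sqrt \<xi>"
    and "xi M S Y = ereal \<xi>"
proof -
  interpret real_density p by (rule is_diff_density_real_density[OF p])
  note [measurable] = borel_measurable_DERIV[OF der]
  have J0: "0 \<le> J"
    using J by (auto simp: has_bochner_integral_iff nonneg intro!: Bochner_Integration.integral_nonneg)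
  have Vi: "integrable M V"
  proof -
    have "(\<lambda>\<omega>. V \<omega>) \<in> borel_measurable M"
      using p distributed_measurable[of M lborel V] by (auto simp: is_diff_density_def)
    then show ?thesis
      by (rule square_integrable_imp_integrable) (use V2 in \<open>auto simp: has_bochner_integral_iff\<close>)
  qed
  then have V1: "has_bochner_integral M V \<mu>"
    by (simp add: has_bochner_integral_iff \<mu>_def mean_SY_def V_def)
  have m1: "has_bochner_integral lborel (\<lambda>y. y * p y) \<mu>"
    by (rule diff_density_integral[OF p]) (use V1 in auto)
  have m2: "has_bochner_integral lborel (\<lambda>y. y\<^sup>2 * p y) 1"
    by (rule diff_density_integral[OF p]) (use V2 in auto)
  define v where "v = 1 - \<mu>\<^sup>2"
  have St: "(1 + \<sigma>\<^sup>2 * J) * smooth_fisher \<sigma> \<le> J" if s: "\<sigma> > 0" for \<sigma>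
  proof -
    define c where "c = 1 + \<sigma>\<^sup>2 * J"
    have c: "c > 0" using J0 by (simp add: c_def add_pos_nonneg)
    \<comment> \<open>The weights \<open>\<sigma>\<^sup>2 J / c\<close> and \<open>1 / c\<close> minimise the bound of \<open>Stam\<close>.\<close>
    have "smooth_fisher \<sigma> \<le> (\<sigma>\<^sup>2 * J / c)\<^sup>2 / \<sigma>\<^sup>2 + (1 / c)\<^sup>2 * J"
      by (rule Stam[OF s der _ J]) (use c in \<open>auto simp: c_def divide_simps\<close>)
    also have "\<dots> = (\<sigma>\<^sup>2 * J * J + J) / c\<^sup>2"
      using s by (simp add: power2_eq_square add_divide_distrib mult_ac)
    also have "\<sigma>\<^sup>2 * J * J + J = J * c" by (simp add: c_def algebra_simps)
    also have "J * c / c\<^sup>2 = J / c" using c by (simp add: power2_eq_square)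
    finally show ?thesis using c by (simp add: c_def pos_le_divide_eq mult.commute)
  qed
  have opt: "sigma_opt M S Y G \<delta> = (LEAST \<sigma>. 0 \<le> \<sigma> \<and> kappa_of smooth_fisher \<sigma> = 1 / \<delta>)"
  proof -
    have "kappa M S Y G \<sigma> = kappa_of smooth_fisher \<sigma>" if "0 \<le> \<sigma>" for \<sigma>
    proof (cases "\<sigma> = 0")
      case False
      then have "\<sigma> > 0" using that by simp
      from smoothed_fisher_info[OF G p ind this]
      have "enn2real (fisher_info M (W_var S Y G \<sigma>)) = smooth_fisher \<sigma>"
        by (simp add: W_var_def V_def smooth_fisher_nonneg)
      then show ?thesis using False by (simp add: kappa_def kappa_of_def Let_def)
    qed (simp add: kappa_def kappa_of_def)
    then show ?thesis unfolding sigma_opt_def by (intro arg_cong[where f=Least] ext) auto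
  qed
  have CR: "1 \<le> (\<sigma>\<^sup>2 + v) * smooth_fisher \<sigma>" if "\<sigma> > 0" for \<sigma>
    using Cramer_Rao[OF that m1 m2] by (simp add: v_def)
  have v1: "v < 1" using \<mu> by (simp add: v_def)
  note K = kappa_least_solution[OF continuous_smooth_fisher CR St v1 J0 \<delta>, folded opt]
  have v: "0 < v" and o0: "0 < sigma_opt M S Y G \<delta>" and J1: "1 < J" using K by auto
  have vm: "1 - v = \<mu>\<^sup>2" by (simp add: v_def)
  define L where "L = (sigma_LS M S Y \<delta>)\<^sup>2"
  define P where "P = (sigma_opt M S Y G \<delta>)\<^sup>2"
  have L: "L = v / ((1 - v) * (\<delta> - 1))"
    unfolding L_def sigma_LS_def alpha_LS_def \<mu>_def[symmetric] vm using v \<delta>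
    by (simp add: power_divide power_mult_distrib v_def)
  have P0: "0 < P" using o0 by (simp add: P_def)
  have PL: "P \<le> L" using K(3) by (simp add: P_def L)
  have Pge: "1 / ((J - 1) * (\<delta> - 1)) \<le> P" using K(4) by (simp add: P_def)
  have \<xi>: "\<xi> = (J - 1) * (v / (1 - v))" by (simp add: \<xi>_def v_def)
  have "L = \<xi> * (1 / ((J - 1) * (\<delta> - 1)))" using J1 \<delta> by (simp add: L \<xi>)
  also have "\<dots> \<le> \<xi> * P" using Pge J1 v v1 by (intro mult_left_mono) (auto simp: \<xi>)
  finally have LP: "L \<le> \<xi> * P" .
  then show "(sigma_LS M S Y \<delta>)\<^sup>2 / (sigma_opt M S Y G \<delta>)\<^sup>2 \<le> \<xi>"
    using P0 by (simp add: L_def P_def divide_le_eq mult.commute)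
  have \<xi>1: "1 \<le> \<xi>"
  proof -
    have "1 * P \<le> \<xi> * P" using PL LP by simp
    then show ?thesis using P0 by (simp add: mult_le_cancel_right)
  qed
  have "corr_opt M S Y G \<delta> / corr_LS M S Y \<delta> = sqrt ((1 + L) / (1 + P))"
    by (simp add: corr_opt_def corr_LS_def L_def P_def real_sqrt_divide)
  also have "\<dots> \<le> sqrt \<xi>"
  proof (rule real_sqrt_le_mono)
    have "1 + L \<le> \<xi> * (1 + P)" using \<xi>1 LP by (simp add: algebra_simps)
    then show "(1 + L) / (1 + P) \<le> \<xi>" using P0 by (simp add: divide_le_eq mult.commute)
  qed
  finally show "corr_opt M S Y G \<delta> / corr_LS M S Y \<delta> \<le> sqrt \<xi>" .
  have "fisher_info M V = ennreal J"
    unfolding fisher_info_eq[OF p der] using J nonneg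
    by (subst nn_integral_eq_integral) (auto simp: has_bochner_integral_iff)
  then show "xi M S Y = ereal \<xi>"
    using J0 unfolding xi_def V_def[symmetric] \<mu>_def[symmetric]
    by (simp add: \<xi>_def one_ereal_def)
qed

text \<open>Labels are signs, so \<open>(S Y)\<^sup>2 = S\<^sup>2\<close>.\<close>

lemma (in prob_space) label_square_integral:
  assumes "random_label_model M N U f S Y"
  shows "has_bochner_integral M (\<lambda>\<omega>. (S \<omega> * Y \<omega>)\<^sup>2) 1"
proof -
  have U: "U \<in> M \<rightarrow>\<^sub>M N" and f: "\<And>u s. u \<in> space N \<Longrightarrow> f u s \<in> {-1, 1}"
    and S: "distributed M lborel S (\<lambda>x. ennreal (std_normal_density x))" 
    and Y: "\<And>\<omega>. \<omega> \<in> space M \<Longrightarrow> Y \<omega> = f (U \<omega>) (S \<omega>)"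
    using assms by (auto simp: random_label_model_def indep_rv_def)
  have eq: "(S \<omega> * Y \<omega>)\<^sup>2 = (S \<omega>)\<^sup>2" if "\<omega> \<in> space M" for \<omega>
    using f[of "U \<omega>" "S \<omega>"] measurable_space[OF U that] Y[OF that] by (auto simp: power_mult_distrib)
  have "has_bochner_integral M (\<lambda>\<omega>. (S \<omega>)\<^sup>2) 1"
    using distributed_integrable[OF S, of "\<lambda>x. x\<^sup>2"] distributed_integral[OF S, of "\<lambda>x. x\<^sup>2"]
      std_normal_moment_even[of 1] by (auto simp: has_bochner_integral_iff)
  then show ?thesis by (subst has_bochner_integral_cong[OF refl eq refl]) auto
qed

text \<open>Equality would make \<open>S Y\<close> almost surely constant, which a density excludes. This keeps
  \<open>\<infinity> * 0\<close> out of \<open>\<xi>\<close> when the Fisher information is infinite.\<close>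

lemma (in prob_space) mean_SY_sq_less_1:
  assumes V2: "has_bochner_integral M (\<lambda>\<omega>. (S \<omega> * Y \<omega>)\<^sup>2) (1::real)"
    and p: "is_diff_density M (\<lambda>\<omega>. S \<omega> * Y \<omega>) p"
  shows "(mean_SY M S Y)\<^sup>2 < 1"
proof -
  define V where "V = (\<lambda>\<omega>. S \<omega> * Y \<omega>)"
  define \<mu> where "\<mu> = mean_SY M S Y"
  have D: "distributed M lborel V (\<lambda>x. ennreal (p x))" using p by (simp add: is_diff_density_def V_def)
  then have [measurable]: "V \<in> borel_measurable M" using distributed_measurable[of M lborel V] by auto
  have V2': "integrable M (\<lambda>\<omega>. (V \<omega>)\<^sup>2)" using V2 by (simp add: has_bochner_integral_iff V_def)
  have Vi: "integrable M V" by (rule square_integrable_imp_integrable[OF _ V2']) auto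
  have EV: "expectation V = \<mu>" by (simp add: \<mu>_def mean_SY_def V_def)
  have var: "variance V = 1 - \<mu>\<^sup>2"
    using variance_eq[OF Vi V2'] V2 EV by (simp add: has_bochner_integral_iff V_def)
  have "0 \<le> variance V" by simp
  moreover have "variance V \<noteq> 0"
  proof
    assume "variance V = 0"
    then have "AE \<omega> in M. (V \<omega> - \<mu>)\<^sup>2 = 0"
      unfolding EV
    proof (subst (asm) integral_nonneg_eq_0_iff_AE)
      show "integrable M (\<lambda>\<omega>. (V \<omega> - \<mu>)\<^sup>2)" using Vi V2' by (simp add: power2_diff)
    qed auto
    then have "AE \<omega> in M. V \<omega> = \<mu>" by eventually_elim simp
    then have "AE x in distr M borel V. x = \<mu>" by (subst AE_distr_iff) auto
    moreover have "distr M borel V = density lborel (\<lambda>x. ennreal (p x))"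
      using distributed_distr_eq_density[OF D] by (simp cong: distr_cong)
    ultimately have "AE x in density lborel (\<lambda>x. ennreal (p x)). x = \<mu>" by argo
    then have "AE x in lborel. 0 < ennreal (p x) \<longrightarrow> x = \<mu>"
      using distributed_borel_measurable[OF D] by (subst (asm) AE_density) auto
    moreover have "AE x in lborel. x \<noteq> \<mu>" by (rule AE_lborel_singleton)
    ultimately have "AE x in lborel. p x = 0"
      by eventually_elim (use p in \<open>auto simp: is_diff_density_def less_le\<close>)
    then have "(\<integral>x. p x \<partial>lborel) = 0" by (rule integral_eq_zero_AE)
    then show False
      using is_diff_density_real_density[OF p] by (simp add: real_density_def has_bochner_integral_iff)
  qed
  ultimately show ?thesis unfolding var \<mu>_def[symmetric] by simp
qed

lemma (in prob_space) ratio_bounds_ereal: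
  assumes "random_label_model M N U f S Y"
    and G: "distributed M lborel G (\<lambda>x. ennreal (std_normal_density x))"
    and ind: "indep_rv M borel G (borel \<Otimes>\<^sub>M borel) (\<lambda>\<omega>. (S \<omega>, Y \<omega>))"
    and \<mu>: "mean_SY M S Y > 0" and d: "has_diff_density M (\<lambda>\<omega>. S \<omega> * Y \<omega>)" and \<delta>: "\<delta> > 1"
  shows "ereal ((sigma_LS M S Y \<delta>)\<^sup>2 / (sigma_opt M S Y G \<delta>)\<^sup>2) \<le> xi M S Y \<and>
           ereal (corr_opt M S Y G \<delta> / corr_LS M S Y \<delta>) \<le> ereal_sqrt (xi M S Y)"
proof -
  obtain p where p: "is_diff_density M (\<lambda>\<omega>. S \<omega> * Y \<omega>) p" using d by (auto simp: has_diff_density_def)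
  define p' where "p' = deriv p"
  have der: "(p has_real_derivative p' y) (at y)" for y
    using p unfolding is_diff_density_def p'_def using DERIV_deriv_iff_real_differentiable by blast
  note V2 = label_square_integral[OF assms(1)]
  note iv = indep_rv_imp_indep_var[OF ind]
  have p0: "\<And>y. 0 \<le> p y" using p by (simp add: is_diff_density_def)
  note [measurable] = borel_measurable_DERIV[OF der]
  have [measurable]: "p \<in> borel_measurable borel"
    by (intro borel_measurable_continuous_onI) (meson DERIV_isCont continuous_at_imp_continuous_on der)
  note J = fisher_info_eq[OF p der]
  show ?thesis
  proof (cases "fisher_info M (\<lambda>\<omega>. S \<omega> * Y \<omega>) = \<infinity>")
    case True
    define c where "c = (1 - (mean_SY M S Y)\<^sup>2) / (mean_SY M S Y)\<^sup>2"
    have "0 < c"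
      using mean_SY_sq_less_1[OF V2 p] \<mu> by (simp add: c_def)
    then have "xi M S Y = \<infinity>" unfolding xi_def True c_def[symmetric] by simp
    then show ?thesis by (simp add: ereal_sqrt_def)
  next
    case False
    then obtain J where "0 \<le> J" "(\<integral>\<^sup>+x. ennreal ((p' x)\<^sup>2 / p x) \<partial>lborel) = ennreal J"
      unfolding J by (cases "\<integral>\<^sup>+x. ennreal ((p' x)\<^sup>2 / p x) \<partial>lborel") (auto simp: top_ennreal_def)
    then have "has_bochner_integral lborel (\<lambda>x. (p' x)\<^sup>2 / p x) J"
      by (intro has_bochner_integral_nn_integral) (auto simp: p0)
    note R = ratio_bounds[OF G iv V2 p der this \<mu> \<delta>]
    show ?thesis using R by (simp add: ereal_sqrt_def)
  qed
qed

section \<open>Symmetric label models\<close>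

lemma (in prob_space) indep_rv_distr_pair:
  assumes "indep_rv M A X B Z"
  shows "distr M (A \<Otimes>\<^sub>M B) (\<lambda>\<omega>. (X \<omega>, Z \<omega>)) = distr M A X \<Otimes>\<^sub>M distr M B Z"
proof -
  have m[measurable]: "X \<in> M \<rightarrow>\<^sub>M A" "Z \<in> M \<rightarrow>\<^sub>M B"
    and ind: "indep_set {X -` E \<inter> space M | E. E \<in> sets A} {Z -` E \<inter> space M | E. E \<in> sets B}"
    using assms by (auto simp: indep_rv_def)
  interpret X: prob_space "distr M A X" by (rule prob_space_distr) fact
  interpret Z: prob_space "distr M B Z" by (rule prob_space_distr) fact
  show ?thesis
  proof (rule pair_measure_eqI[symmetric])
    show "sets (distr M A X \<Otimes>\<^sub>M distr M B Z) = sets (distr M (A \<Otimes>\<^sub>M B) (\<lambda>\<omega>. (X \<omega>, Z \<omega>)))"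
      by simp
    fix E F assume "E \<in> sets (distr M A X)" "F \<in> sets (distr M B Z)"
    then have [measurable]: "E \<in> sets A" "F \<in> sets B" by auto
    have "prob ((X -` E \<inter> space M) \<inter> (Z -` F \<inter> space M)) = prob (X -` E \<inter> space M) * prob (Z -` F \<inter> space M)"
      by (rule indep_setD[OF ind]) auto
    moreover have "(\<lambda>\<omega>. (X \<omega>, Z \<omega>)) -` (E \<times> F) \<inter> space M = (X -` E \<inter> space M) \<inter> (Z -` F \<inter> space M)" by auto
    ultimately show "emeasure (distr M A X) E * emeasure (distr M B Z) F =
       emeasure (distr M (A \<Otimes>\<^sub>M B) (\<lambda>\<omega>. (X \<omega>, Z \<omega>))) (E \<times> F)"
      by (simp add: emeasure_distr emeasure_eq_measure ennreal_mult)
  qed unfold_locales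
qed

text \<open>Conditionally on \<open>S = s\<close>, the product is \<open>s\<close> with probability \<open>q s\<close> and \<open>- s\<close> otherwise;
  reflecting the second part gives the density.\<close>

lemma (in prob_space) label_product_distributed:
  assumes rl: "random_label_model M N U f S Y"
    and q: "\<And>s. prob {\<omega> \<in> space M. f (U \<omega>) s = 1} = q s" and qm[measurable]: "q \<in> borel_measurable borel"
    and V: "(\<lambda>\<omega>. S \<omega> * Y \<omega>) \<in> borel_measurable M"
  shows "distributed M lborel (\<lambda>\<omega>. S \<omega> * Y \<omega>)
    (\<lambda>v. ennreal (std_normal_density v * (q v + (1 - q (- v)))))"
proof -
  have U[measurable]: "U \<in> M \<rightarrow>\<^sub>M N" and f: "\<And>u s. u \<in> space N \<Longrightarrow> f u s \<in> {-1, 1}"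
    and fm[measurable]: "(\<lambda>(u, s). f u s) \<in> N \<Otimes>\<^sub>M borel \<rightarrow>\<^sub>M borel"
    and S: "distributed M lborel S (\<lambda>x. ennreal (std_normal_density x))" 
    and ind: "indep_rv M N U borel S" and Sm[measurable]: "S \<in> borel_measurable M"
    and Y: "\<And>\<omega>. \<omega> \<in> space M \<Longrightarrow> Y \<omega> = f (U \<omega>) (S \<omega>)"
    using rl by (auto simp: random_label_model_def indep_rv_def)
  have q01: "0 \<le> q s" "q s \<le> 1" for s
    unfolding q[of s, symmetric] by auto
  interpret DU: prob_space "distr M N U" by (rule prob_space_distr) fact
  interpret DS: prob_space "distr M borel S" by (rule prob_space_distr) fact
  interpret DP: pair_sigma_finite "distr M N U" "distr M borel S" ..
  have inner: "(\<integral>\<^sup>+\<omega>. indicator A (s * f (U \<omega>) s) \<partial>M) = ennreal (q s) * indicator A s + ennreal (1 - q s) * indicator A (- s)"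
    for A :: "real set" and s
  proof -
    let ?E = "{\<omega> \<in> space M. f (U \<omega>) s = 1}"
    have E[measurable]: "?E \<in> sets M" by measurable
    have "(\<integral>\<^sup>+\<omega>. indicator A (s * f (U \<omega>) s) \<partial>M) =
      (\<integral>\<^sup>+\<omega>. indicator A s * indicator ?E \<omega> + indicator A (- s) * indicator (space M - ?E) \<omega> \<partial>M)"
    proof (intro nn_integral_cong)
      fix \<omega> assume w: "\<omega> \<in> space M"
      then have "f (U \<omega>) s \<in> {-1, 1}" using f[of "U \<omega>" s] measurable_space[OF U w] by simp
      then show "indicator A (s * f (U \<omega>) s) =
          (indicator A s :: ennreal) * indicator ?E \<omega> + indicator A (- s) * indicator (space M - ?E) \<omega>"
        using w by (auto simp: indicator_def)
    qed
    also have "\<dots> = indicator A s * emeasure M ?E + indicator A (- s) * emeasure M (space M - ?E)"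
      by (subst nn_integral_add) (auto simp: nn_integral_cmult_indicator)
    also have "\<dots> = ennreal (q s) * indicator A s + ennreal (1 - q s) * indicator A (- s)"
      using prob_compl[OF E] by (simp add: emeasure_eq_measure q mult.commute)
    finally show ?thesis .
  qed
  have dens: "distr M borel S = density lborel (\<lambda>x. ennreal (std_normal_density x))"
    using distributed_distr_eq_density[OF S] by (simp cong: distr_cong)
  have "emeasure M ((\<lambda>\<omega>. S \<omega> * Y \<omega>) -` A \<inter> space M) =
     (\<integral>\<^sup>+v. ennreal (std_normal_density v * (q v + (1 - q (- v)))) * indicator A v \<partial>lborel)"
    if A[measurable]: "A \<in> sets borel" for A
  proof -
    have "emeasure M ((\<lambda>\<omega>. S \<omega> * Y \<omega>) -` A \<inter> space M) = (\<integral>\<^sup>+\<omega>. indicator A (S \<omega> * Y \<omega>) \<partial>M)"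
      by (subst nn_integral_indicator[symmetric])
         (auto intro!: measurable_sets[OF V] nn_integral_cong simp: indicator_def)
    also have "\<dots> = (\<integral>\<^sup>+\<omega>. (\<lambda>(u, s). indicator A (s * f u s)) (U \<omega>, S \<omega>) \<partial>M)"
      by (intro nn_integral_cong) (simp add: Y)
    also have "\<dots> = (\<integral>\<^sup>+z. (\<lambda>(u, s). indicator A (s * f u s)) z \<partial>distr M (N \<Otimes>\<^sub>M borel) (\<lambda>\<omega>. (U \<omega>, S \<omega>)))"
      by (subst nn_integral_distr) auto
    also have "\<dots> = (\<integral>\<^sup>+s. \<integral>\<^sup>+u. indicator A (s * f u s) \<partial>distr M N U \<partial>distr M borel S)"
      unfolding indep_rv_distr_pair[OF ind]
      by (subst DP.nn_integral_snd[symmetric]) auto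
    also have "\<dots> = (\<integral>\<^sup>+s. ennreal (q s) * indicator A s + ennreal (1 - q s) * indicator A (- s) \<partial>distr M borel S)"
      by (subst nn_integral_distr) (auto simp: inner)
    also have "\<dots> = (\<integral>\<^sup>+s. ennreal (std_normal_density s * q s) * indicator A s +
         ennreal (std_normal_density s * (1 - q s)) * indicator A (- s) \<partial>lborel)"
      unfolding dens by (subst nn_integral_density) (auto simp: distrib_left ennreal_mult' mult.assoc)
    also have "\<dots> = (\<integral>\<^sup>+s. ennreal (std_normal_density s * q s) * indicator A s \<partial>lborel) +
        (\<integral>\<^sup>+s. ennreal (std_normal_density s * (1 - q s)) * indicator A (- s) \<partial>lborel)"
      by (rule nn_integral_add) auto
    also have "(\<integral>\<^sup>+s. ennreal (std_normal_density s * (1 - q s)) * indicator A (- s) \<partial>lborel) =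
        (\<integral>\<^sup>+s. ennreal (std_normal_density s * (1 - q (- s))) * indicator A s \<partial>lborel)"
      by (subst nn_integral_real_affine[where c="-1" and t=0]) (auto simp: std_normal_density_def)
    also have "(\<integral>\<^sup>+s. ennreal (std_normal_density s * q s) * indicator A s \<partial>lborel) +
        (\<integral>\<^sup>+s. ennreal (std_normal_density s * (1 - q (- s))) * indicator A s \<partial>lborel) =
        (\<integral>\<^sup>+s. ennreal (std_normal_density s * q s) * indicator A s +
           ennreal (std_normal_density s * (1 - q (- s))) * indicator A s \<partial>lborel)"
      by (rule nn_integral_add[symmetric]) auto
    also have "\<dots> = (\<integral>\<^sup>+v. ennreal (std_normal_density v * (q v + (1 - q (- v)))) * indicator A v \<partial>lborel)"
      by (intro nn_integral_cong) (auto simp: indicator_def distrib_left ennreal_plus[symmetric] q01 simp del: ennreal_plus)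
    finally show ?thesis .
  qed
  then have "distr M lborel (\<lambda>\<omega>. S \<omega> * Y \<omega>) = density lborel (\<lambda>v. ennreal (std_normal_density v * (q v + (1 - q (- v)))))"
    by (intro measure_eqI) (auto simp: emeasure_distr V emeasure_density)
  then show ?thesis using V by (simp add: distributed_def)
qed

lemma has_bochner_integral_symmetrize:
  fixes F :: "real \<Rightarrow> real"
  assumes [measurable]: "F \<in> borel_measurable borel" and F0: "\<And>v. 0 \<le> F v"
    and i: "has_bochner_integral lborel (\<lambda>v. F v + F (- v)) (2 * c)"
  shows "has_bochner_integral lborel F c"
proof -
  have F: "integrable lborel F"
    by (rule Bochner_Integration.integrable_bound[of _ "\<lambda>v. F v + F (- v)"])
       (use i F0 in \<open>auto simp: has_bochner_integral_iff\<close>)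
  have "integrable lborel (\<lambda>v. F (- v))" "(\<integral>v. F (- v) \<partial>lborel) = (\<integral>v. F v \<partial>lborel)"
    using lborel_integrable_real_affine_iff[of "-1" F 0] lborel_integral_real_affine[of "-1" F 0] F by auto
  then show ?thesis using i F by (auto simp: has_bochner_integral_iff)
qed

text \<open>For a label probability with \<open>q (- s) = 1 - q s\<close> the density of \<open>S Y\<close> is \<open>2 \<phi> q\<close>, and both
  ingredients of \<open>\<xi>\<close> become Gaussian integrals of \<open>r = q'\<close>: the mean is \<open>2 \<integral> \<phi> r\<close>, by Gaussian integration
  by parts, and \<open>J - 1 = \<integral> \<phi> r\<^sup>2 / (q (1 - q))\<close>, by averaging the information density over \<open>v\<close> and
  \<open>- v\<close>.\<close>

lemma (in prob_space) symmetric_label_bound: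
  fixes q r :: "real \<Rightarrow> real"
  assumes rl: "random_label_model M N U f S Y"
    and G: "distributed M lborel G (\<lambda>x. ennreal (std_normal_density x))"
    and ind: "indep_rv M borel G (borel \<Otimes>\<^sub>M borel) (\<lambda>\<omega>. (S \<omega>, Y \<omega>))"
    and q: "\<And>s. prob {\<omega> \<in> space M. f (U \<omega>) s = 1} = q s"
    and der: "\<And>s. (q has_real_derivative r s) (at s)"
    and q01: "\<And>s. 0 < q s" "\<And>s. q (- s) = 1 - q s" and even: "\<And>s. r (- s) = r s"
    and R: "has_bochner_integral lborel (\<lambda>v. std_normal_density v * r v) R" "R > 0"
    and K: "has_bochner_integral lborel (\<lambda>v. std_normal_density v * ((r v)\<^sup>2 / (q v * (1 - q v)))) K"
    and c: "0 < c" "K * ((1 - (2 * R)\<^sup>2) / (2 * R)\<^sup>2) \<le> (1 / c)\<^sup>2" and \<delta>: "\<delta> > 1"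
  shows "corr_LS M S Y \<delta> \<ge> c * corr_opt M S Y G \<delta>"
proof -
  let ?\<phi> = std_normal_density
  define V where "V = (\<lambda>\<omega>. S \<omega> * Y \<omega>)"
  define p where "p v = 2 * (?\<phi> v * q v)" for v
  define d where "d v = 2 * (?\<phi> v * r v - v * (?\<phi> v * q v))" for v
  have q1: "q s < 1" for s using q01(1)[of "- s"] q01(2)[of s] by simp
  have qm[measurable]: "q \<in> borel_measurable borel"
    by (intro borel_measurable_continuous_onI) (meson DERIV_isCont continuous_at_imp_continuous_on der)
  note rm[measurable] = borel_measurable_DERIV[OF der]
  have dphi: "(?\<phi> has_real_derivative - v * ?\<phi> v) (at v)" for v
    using DERIV_gauss[of 1 v] by (simp add: gauss_deriv_def)
  have derfq: "((\<lambda>v. ?\<phi> v * q v) has_real_derivative ?\<phi> v * r v - v * (?\<phi> v * q v)) (at v)" for v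
    by (auto intro!: derivative_eq_intros dphi der)
  have dp: "(p has_real_derivative d v) (at v)" for v
    unfolding p_def[abs_def] d_def by (intro DERIV_cmult derfq)
  note V2 = label_square_integral[OF rl]
  have "(\<lambda>\<omega>. (S \<omega>, Y \<omega>)) \<in> M \<rightarrow>\<^sub>M borel \<Otimes>\<^sub>M borel" using ind by (simp add: indep_rv_def)
  from measurable_compose[OF this, of "\<lambda>z. fst z * snd z" borel]
  have "V \<in> borel_measurable M" by (simp add: V_def)
  from label_product_distributed[OF rl q qm this[unfolded V_def]]
  have D: "distributed M lborel V (\<lambda>v. ennreal (p v))"
    unfolding q01(2) by (simp add: p_def V_def algebra_simps)
  have pd: "is_diff_density M V p"
    unfolding is_diff_density_def using D dp q01(1)
    by (auto simp: p_def[of "_::real"] less_imp_le real_differentiable_def intro!: mult_nonneg_nonneg)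
  have pi: "has_bochner_integral lborel p 1"
    using is_diff_density_real_density[OF pd] by (simp add: real_density_def)
  have V1: "integrable M V"
    by (rule square_integrable_imp_integrable) (use V2 \<open>V \<in> borel_measurable M\<close> in \<open>auto simp: V_def has_bochner_integral_iff\<close>)
  have mp: "has_bochner_integral lborel (\<lambda>v. v * p v) (mean_SY M S Y)"
    by (rule diff_density_integral[OF pd]) (use V1 in \<open>auto simp: has_bochner_integral_iff mean_SY_def V_def\<close>)
  have di: "has_bochner_integral lborel d (2 * R - mean_SY M S Y)"
    using has_bochner_integral_diff[OF has_bochner_integral_mult_right[OF R(1), of 2] mp]
    by (simp add: d_def[abs_def] p_def algebra_simps)
  have mean: "mean_SY M S Y = 2 * R"
    using integral_derivative_eq_0[OF dp] pi di by (auto simp: has_bochner_integral_iff)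
  have J: "has_bochner_integral lborel (\<lambda>v. (d v)\<^sup>2 / p v) (1 + K)"
  proof (rule has_bochner_integral_symmetrize)
    show "(\<lambda>v. (d v)\<^sup>2 / p v) \<in> borel_measurable borel" unfolding d_def p_def by measurable
    show "0 \<le> (d v)\<^sup>2 / p v" for v using q01(1)[of v] by (auto simp: p_def intro!: divide_nonneg_nonneg mult_nonneg_nonneg)
    have eq: "(d v)\<^sup>2 / p v + (d (- v))\<^sup>2 / p (- v) = 2 * (?\<phi> v * v ^ (2 * 1) + ?\<phi> v * ((r v)\<^sup>2 / (q v * (1 - q v))))" for v
    proof -
      have f0: "0 < ?\<phi> v" by (rule normal_density_pos) simp
      have 1: "(2 * (F * r' - w * (F * Q)))\<^sup>2 / (2 * (F * Q)) = 2 * F * (r'\<^sup>2 / Q - 2 * w * r' + w\<^sup>2 * Q)"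
        if "F > 0" "Q > 0" for F Q w r' :: real
        using that by (simp add: field_simps power2_eq_square)
      have fs: "?\<phi> (- v) = ?\<phi> v" by (simp add: std_normal_density_def)
      have "(d v)\<^sup>2 / p v = 2 * ?\<phi> v * ((r v)\<^sup>2 / q v - 2 * v * r v + v\<^sup>2 * q v)"
        unfolding d_def p_def by (rule 1[OF f0 q01(1)])
      moreover have "(d (- v))\<^sup>2 / p (- v) = 2 * ?\<phi> v * ((r v)\<^sup>2 / (1 - q v) - 2 * (- v) * r v + (- v)\<^sup>2 * (1 - q v))"
        unfolding d_def p_def fs q01(2) even by (rule 1[OF f0]) (use q1[of v] in simp)
      ultimately have "(d v)\<^sup>2 / p v + (d (- v))\<^sup>2 / p (- v) =
          2 * ?\<phi> v * (((r v)\<^sup>2 / q v + (r v)\<^sup>2 / (1 - q v)) + v\<^sup>2)"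
        by (simp add: algebra_simps)
      also have "(r v)\<^sup>2 / q v + (r v)\<^sup>2 / (1 - q v) = (r v)\<^sup>2 / (q v * (1 - q v))"
        using q01(1)[of v] q1[of v] by (simp add: field_simps)
      finally show ?thesis by (simp add: distrib_left)
    qed
    show "has_bochner_integral lborel (\<lambda>v. (d v)\<^sup>2 / p v + (d (- v))\<^sup>2 / p (- v)) (2 * (1 + K))"
      unfolding eq
      using has_bochner_integral_mult_right[OF has_bochner_integral_add[OF std_normal_moment_even[of 1] K], of 2]
      by simp
  qed
  have "corr_opt M S Y G \<delta> / corr_LS M S Y \<delta> \<le> sqrt ((1 + K - 1) * ((1 - (mean_SY M S Y)\<^sup>2) / (mean_SY M S Y)\<^sup>2))"
    by (rule ratio_bounds(2)[OF G indep_rv_imp_indep_var[OF ind] V2 pd[unfolded V_def] dp J _ \<delta>])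
       (use mean R in auto)
  also have "\<dots> \<le> sqrt ((1 / c)\<^sup>2)"
    unfolding mean using c by (intro real_sqrt_le_mono) simp
  finally have "corr_opt M S Y G \<delta> / corr_LS M S Y \<delta> \<le> 1 / c" using c by simp
  moreover have "0 < corr_LS M S Y \<delta>"
    unfolding corr_LS_def by (intro divide_pos_pos) (auto intro!: add_pos_nonneg)
  ultimately show ?thesis using c by (simp add: divide_simps mult.commute)
qed

section \<open>The logistic model\<close>

text \<open>Completion of the square.\<close>

lemma std_normal_times_gauss:
  fixes b c v :: real
  assumes b: "b > -1/2"
  defines "t \<equiv> 1 / sqrt (2 * b + 1)"
  shows "std_normal_density v * exp (- b * v\<^sup>2) * exp (c * v)
    = t * exp ((c * t)\<^sup>2 / 2) * normal_density (c * t\<^sup>2) t v"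
proof -
  have t: "t > 0" "t\<^sup>2 = 1 / (2 * b + 1)" using b by (auto simp: t_def power_divide)
  have "- v\<^sup>2 / 2 + - b * v\<^sup>2 + c * v = (c * t)\<^sup>2 / 2 + (- (v - c * t\<^sup>2)\<^sup>2 / (2 * t\<^sup>2))"
  proof -
    have "(v - c * T)\<^sup>2 / (2 * T) = v\<^sup>2 * (1 / T) / 2 - c * v + c\<^sup>2 * T / 2" if "T > 0" for T
      using that by (simp add: field_simps power2_eq_square)
    moreover have "1 / t\<^sup>2 = 2 * b + 1" by (simp add: t(2))
    ultimately have "(v - c * t\<^sup>2)\<^sup>2 / (2 * t\<^sup>2) = v\<^sup>2 * (2 * b + 1) / 2 - c * v + c\<^sup>2 * t\<^sup>2 / 2"
      using t(1) by (metis zero_less_power)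
    then show ?thesis by (simp add: power_mult_distrib algebra_simps)
  qed
  then have "exp (- v\<^sup>2 / 2) * exp (- b * v\<^sup>2) * exp (c * v) = exp ((c * t)\<^sup>2 / 2) * exp (- (v - c * t\<^sup>2)\<^sup>2 / (2 * t\<^sup>2))"
    unfolding exp_add[symmetric] by simp
  moreover have "1 / sqrt (2 * pi) = t * (1 / sqrt (2 * pi * t\<^sup>2))"
    using t(1) by (simp add: real_sqrt_mult)
  ultimately show ?thesis
    unfolding std_normal_density_def normal_density_def[of "c * t\<^sup>2"] by (simp add: mult.assoc)
qed

lemma std_normal_times_gauss_integral:
  fixes b c :: real
  assumes b: "b > -1/2"
  shows "has_bochner_integral lborel (\<lambda>v. std_normal_density v * exp (- b * v\<^sup>2) * exp (c * v))
    (exp (c\<^sup>2 / (2 * (2 * b + 1))) / sqrt (2 * b + 1))"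
proof -
  define t where "t = 1 / sqrt (2 * b + 1)"
  have t: "t > 0" "t\<^sup>2 = 1 / (2 * b + 1)" using b by (auto simp: t_def power_divide)
  have "has_bochner_integral lborel (\<lambda>v. t * exp ((c * t)\<^sup>2 / 2) * normal_density (c * t\<^sup>2) t v) (t * exp ((c * t)\<^sup>2 / 2) * 1)"
    by (intro has_bochner_integral_mult_right) (use t in \<open>auto simp: has_bochner_integral_iff\<close>)
  moreover have "t * exp ((c * t)\<^sup>2 / 2) * 1 = exp (c\<^sup>2 / (2 * (2 * b + 1))) / sqrt (2 * b + 1)"
    unfolding power_mult_distrib t(2) by (simp add: t_def mult.commute)
  ultimately show ?thesis
    unfolding std_normal_times_gauss[OF b, folded t_def] by simp
qed

definition logistic :: "real \<Rightarrow> real" where "logistic v = 1 / (1 + exp (- v))"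

definition logistic_deriv :: "real \<Rightarrow> real" where "logistic_deriv v = logistic v * (1 - logistic v)"

lemma logistic_01: "0 < logistic v" "logistic v < 1" "logistic (- v) = 1 - logistic v"
proof -
  have "1 + exp v \<noteq> 0" "1 + exp (-v) \<noteq> 0" by (metis add_pos_pos exp_gt_zero less_irrefl zero_less_one)+
  then show "logistic (- v) = 1 - logistic v"
    by (simp add: logistic_def field_simps exp_minus)
qed (auto simp: logistic_def add_pos_pos)

lemma DERIV_logistic: "(logistic has_real_derivative logistic_deriv v) (at v)"
proof -
  have n: "1 + exp (-v) \<noteq> 0" by (metis add_pos_pos exp_gt_zero less_irrefl zero_less_one)
  then show ?thesis
    unfolding logistic_def[abs_def] logistic_deriv_def
    by (auto intro!: derivative_eq_intros simp: field_simps power2_eq_square)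
qed

text \<open>With \<open>C = (1 + cosh v) / 2\<close> one has \<open>4 * logistic_deriv v = 1 / C\<close>, and \<open>1 / C \<ge> 2 g - C g\<^sup>2\<close>
  for any \<open>g\<close>. The choice of \<open>g\<close> close to \<open>1 / C\<close> as a Gaussian makes the bound sharp enough and
  its Gaussian integral elementary.\<close>

lemma logistic_deriv_lower:
  defines "g \<equiv> \<lambda>v::real. exp (- v\<^sup>2 / 4)"
  shows "2 * g v - (g v)\<^sup>2 * ((1 + cosh v) / 2) \<le> 4 * logistic_deriv v"
proof -
  define C where "C = (1 + cosh v) / 2"
  have C: "C > 0" using cosh_real_pos[of v] by (simp add: C_def add_pos_pos)
  have "logistic_deriv v = 1 / (4 * C)"
  proof -
    have "logistic_deriv v = logistic v * logistic (- v)"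
      using logistic_01(3)[of v] by (simp add: logistic_deriv_def)
    also have "\<dots> = 1 / ((1 + exp (- v)) * (1 + exp v))" by (simp add: logistic_def)
    also have "(1 + exp (- v)) * (1 + exp v) = 4 * C"
      by (simp add: C_def cosh_field_def algebra_simps exp_minus)
    finally show ?thesis .
  qed
  moreover have "2 * g v - (g v)\<^sup>2 * C \<le> 1 / C"
  proof -
    have "0 \<le> (1 - C * g v)\<^sup>2" by simp
    then have "(2 * g v - (g v)\<^sup>2 * C) * C \<le> 1" by (simp add: power2_eq_square algebra_simps)
    then show ?thesis using C by (simp add: pos_le_divide_eq)
  qed
  ultimately show ?thesis unfolding C_def[symmetric] by simp
qed

text \<open>Integrating the preceding bound gives \<open>2 sqrt (2/3) - (1 + exp (1/4)) / (2 sqrt 2)\<close>, about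
  \<open>0.82547\<close>, as a lower bound for four times the integral.\<close>

lemma logistic_deriv_integral:
  "integrable lborel (\<lambda>v. std_normal_density v * logistic_deriv v)"
  "0.20633 \<le> (\<integral>v. std_normal_density v * logistic_deriv v \<partial>lborel)"
proof -
  let ?\<phi> = std_normal_density
  have [measurable]: "logistic_deriv \<in> borel_measurable borel"
    by (rule borel_measurable_DERIV[OF DERIV_logistic])
  have le1: "0 \<le> logistic_deriv v" "logistic_deriv v \<le> 1" for v
    using logistic_01[of v] by (auto simp: logistic_deriv_def mult_le_one)
  show i: "integrable lborel (\<lambda>v. ?\<phi> v * logistic_deriv v)"
    by (rule Bochner_Integration.integrable_bound[of _ ?\<phi>]) (auto simp: le1 abs_mult intro!: mult_left_le)
  define E :: real where "E = exp (1/4)"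
  \<comment> \<open>The constant is chosen so that its fourth power exceeds \<open>2.72\<close>.\<close>
  have E: "E \<le> 1.2843"
  proof -
    have "E ^ 4 = exp 1" by (simp add: E_def exp_of_nat_mult[symmetric])
    also have "\<dots> \<le> 1.2843 ^ 4" using e_less_272 by (simp add: power4_eq_xxxx)
    finally show ?thesis using power_le_imp_le_base[of E 3 "1.2843"] by simp
  qed
  define G where "G v = 2 * (?\<phi> v * exp (- (1/4) * v\<^sup>2) * exp (0 * v))
     - (?\<phi> v * exp (- (1/2) * v\<^sup>2) * exp (0 * v) / 2 + ?\<phi> v * exp (- (1/2) * v\<^sup>2) * exp (1 * v) / 4
        + ?\<phi> v * exp (- (1/2) * v\<^sup>2) * exp ((-1) * v) / 4)" for v
  have G: "has_bochner_integral lborel G (2 * (1 / sqrt (3/2)) - (1 / sqrt 2 / 2 + E / sqrt 2 / 4 + E / sqrt 2 / 4))"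
    unfolding G_def
    using std_normal_times_gauss_integral[of "1/4" 0] std_normal_times_gauss_integral[of "1/2" 0]
      std_normal_times_gauss_integral[of "1/2" 1] std_normal_times_gauss_integral[of "1/2" "-1"]
    by (intro has_bochner_integral_diff has_bochner_integral_add has_bochner_integral_mult_right
        has_bochner_integral_divide_zero) (simp_all add: E_def)
  have le: "G v \<le> 4 * (?\<phi> v * logistic_deriv v)" for v
  proof -
    have sq: "(exp (- v\<^sup>2 / 4))\<^sup>2 = exp (- (1/2) * v\<^sup>2)"
      by (simp add: exp_of_nat_mult[symmetric] power2_eq_square exp_add[symmetric])
    have "G v = ?\<phi> v * (2 * exp (- v\<^sup>2 / 4) - (exp (- v\<^sup>2 / 4))\<^sup>2 * ((1 + cosh v) / 2))"
      unfolding sq by (simp add: G_def cosh_field_def algebra_simps)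
    also have "\<dots> \<le> ?\<phi> v * (4 * logistic_deriv v)"
      by (intro mult_left_mono logistic_deriv_lower) auto
    finally show ?thesis by simp
  qed
  have s1: "0.81649 \<le> 1 / sqrt (3/2)"
  proof -
    have "sqrt (3/2) \<le> 1 / 0.81649" by (rule real_le_lsqrt) (auto simp: power2_eq_square)
    then show ?thesis by (simp add: divide_simps)
  qed
  have s2: "1 / sqrt 2 \<le> 0.70711"
  proof -
    have "1 / 0.70711 \<le> sqrt 2" by (rule real_le_rsqrt) (auto simp: power2_eq_square)
    then show ?thesis by (simp add: divide_simps)
  qed
  have "4 * 0.20633 \<le> 2 * 0.81649 - (1 + 1.2843) * 0.70711 / (2::real)" by simp
  also have "\<dots> \<le> 2 * (1 / sqrt (3/2)) - (1 + E) * (1 / sqrt 2) / 2"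
  proof -
    have "(1 + E) * (1 / sqrt 2) \<le> (1 + 1.2843) * 0.70711"
      using E by (intro mult_mono s2) (auto simp: E_def)
    from divide_right_mono[OF this, of 2] show ?thesis
      by (intro diff_mono mult_left_mono[OF s1]) auto
  qed
  also have "\<dots> = (\<integral>v. G v \<partial>lborel)" 
    using G by (simp add: has_bochner_integral_iff add_divide_distrib algebra_simps)
  also have "\<dots> \<le> (\<integral>v. 4 * (?\<phi> v * logistic_deriv v) \<partial>lborel)"
    using G i le by (intro integral_mono) (auto simp: has_bochner_integral_iff)
  finally show "0.20633 \<le> (\<integral>v. ?\<phi> v * logistic_deriv v \<partial>lborel)" by simp
qed

text \<open>Here \<open>r = q (1 - q)\<close>, so \<open>J - 1\<close> and half the mean are the same number \<open>a\<close>, and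
  \<open>\<xi> = 1 / (4 a) - a\<close> decreases in \<open>a\<close>; a lower bound for \<open>a\<close> suffices.\<close>

lemma (in prob_space) logistic_bound:
  assumes rl: "random_label_model M N U f S Y"
    and G: "distributed M lborel G (\<lambda>x. ennreal (std_normal_density x))"
    and ind: "indep_rv M borel G (borel \<Otimes>\<^sub>M borel) (\<lambda>\<omega>. (S \<omega>, Y \<omega>))"
    and log: "logistic_model M U f" and \<delta>: "\<delta> > 1"
  shows "corr_LS M S Y \<delta> \<ge> 0.9972 * corr_opt M S Y G \<delta>"
proof -
  define a where "a = (\<integral>v. std_normal_density v * logistic_deriv v \<partial>lborel)"
  have a: "has_bochner_integral lborel (\<lambda>v. std_normal_density v * logistic_deriv v) a" "0.20633 \<le> a"
    using logistic_deriv_integral by (auto simp: a_def has_bochner_integral_iff)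
  have r: "(logistic_deriv v)\<^sup>2 / (logistic v * (1 - logistic v)) = logistic_deriv v" for v
    using logistic_01[of v] by (simp add: logistic_deriv_def power2_eq_square)
  show ?thesis
  proof (rule symmetric_label_bound[OF rl G ind _ DERIV_logistic logistic_01(1,3) _ a(1) _ _ _ _ \<delta>])
    show "prob {\<omega> \<in> space M. f (U \<omega>) s = 1} = logistic s" for s
      using log by (simp add: logistic_model_def logistic_def)
    show "logistic_deriv (- s) = logistic_deriv s" for s
      using logistic_01(3)[of s] by (simp add: logistic_deriv_def)
    show "has_bochner_integral lborel
        (\<lambda>v. std_normal_density v * ((logistic_deriv v)\<^sup>2 / (logistic v * (1 - logistic v)))) a"
      unfolding r by (rule a)
    have "a * ((1 - (2 * a)\<^sup>2) / (2 * a)\<^sup>2) = 1 / (4 * a) - a"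
      using a(2) by (simp add: field_simps power2_eq_square)
    also have "\<dots> \<le> 1 / (4 * 0.20633) - 0.20633"
      using a(2) by (intro diff_mono divide_left_mono mult_left_mono) auto
    also have "\<dots> \<le> (1 / 0.9972)\<^sup>2" by (simp add: power2_eq_square)
    finally show "a * ((1 - (2 * a)\<^sup>2) / (2 * a)\<^sup>2) \<le> (1 / 0.9972)\<^sup>2" .
  qed (use a in auto)
qed

section \<open>The probit model\<close>

abbreviation "Gauss_cdf \<equiv> cdf std_normal_distribution"

lemma prob_space_std_normal: "prob_space std_normal_distribution"
  using prob_space_normal_density[of 1 0] by simp

lemma Gauss_cdf_minus: "Gauss_cdf (- x) = 1 - Gauss_cdf x"
proof -
  interpret prob_space std_normal_distribution by (rule prob_space_std_normal)
  have "emeasure std_normal_distribution {..-x} = emeasure std_normal_distribution {x<..}"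
  proof -
    have "emeasure std_normal_distribution {..-x} = (\<integral>\<^sup>+v. ennreal (std_normal_density v) * indicator {..-x} v \<partial>lborel)"
      by (subst emeasure_density) auto
    also have "\<dots> = (\<integral>\<^sup>+v. ennreal (std_normal_density v) * indicator {x..} v \<partial>lborel)"
      by (subst nn_integral_real_affine[where c="-1" and t=0])
         (auto simp: std_normal_density_def indicator_def intro!: nn_integral_cong)
    also have "\<dots> = (\<integral>\<^sup>+v. ennreal (std_normal_density v) * indicator {x<..} v \<partial>lborel)"
      by (rule nn_integral_cong_AE) (use AE_lborel_singleton[of x] in \<open>eventually_elim, auto simp: indicator_def\<close>)
    also have "\<dots> = emeasure std_normal_distribution {x<..}"
      by (subst emeasure_density) auto
    finally show ?thesis .
  qed
  moreover have "{x<..} = space std_normal_distribution - {..x}" by auto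
  ultimately show ?thesis
    using prob_compl[of "{..x}"] by (simp add: cdf_def measure_def)
qed

lemma DERIV_Gauss_cdf: "(Gauss_cdf has_real_derivative std_normal_density x) (at x)"
proof -
  interpret D: prob_space std_normal_distribution by (rule prob_space_std_normal)
  interpret finite_borel_measure std_normal_distribution
    by (simp add: finite_borel_measure_def D.finite_measure_axioms finite_borel_measure_axioms_def)
  define a where "a = x - 1"
  have cont: "continuous_on S std_normal_density" for S
    unfolding std_normal_density_def[abs_def] by (intro continuous_intros) auto
  have eq: "Gauss_cdf y = Gauss_cdf a + integral {a..y} std_normal_density" if "a < y" for y
  proof -
    have si: "set_integrable lborel {a<..y} std_normal_density"
      unfolding set_integrable_def by (intro integrable_mult_indicator) auto
    have "Gauss_cdf y - Gauss_cdf a = measure std_normal_distribution {a<..y}"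
      by (rule cdf_diff_eq[OF that])
    also have "\<dots> = (LINT v:{a<..y}|lborel. std_normal_density v)"
    proof -
      have "emeasure std_normal_distribution {a<..y} = (\<integral>\<^sup>+v. ennreal (indicator {a<..y} v * std_normal_density v) \<partial>lborel)"
        by (subst emeasure_density) (auto intro!: nn_integral_cong simp: indicator_def)
      also have "\<dots> = ennreal (LINT v:{a<..y}|lborel. std_normal_density v)"
        using si unfolding set_lebesgue_integral_def set_integrable_def
        by (subst nn_integral_eq_integral) auto
      finally show ?thesis
        by (simp add: measure_def set_lebesgue_integral_def)
    qed
    also have "\<dots> = integral {a<..y} std_normal_density"
      using set_borel_integral_eq_integral(2)[OF si] .
    also have "\<dots> = integral {a..y} std_normal_density"
      by (rule integral_subset_negligible) (auto intro: negligible_subset[of "{a}"])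
    finally show ?thesis by simp
  qed
  have "((\<lambda>y. integral {a..y} std_normal_density) has_real_derivative std_normal_density x) (at x within {a..x+1})"
    by (rule integral_has_real_derivative[OF cont]) (auto simp: a_def)
  then have "((\<lambda>y. integral {a..y} std_normal_density) has_real_derivative std_normal_density x) (at x)"
    by (subst (asm) at_within_Icc_at) (auto simp: a_def)
  then have "((\<lambda>y. Gauss_cdf a + integral {a..y} std_normal_density) has_real_derivative std_normal_density x) (at x)"
    by (auto intro!: derivative_eq_intros)
  then show ?thesis
    by (rule has_field_derivative_transform_within_open[where S="{a<..}"]) (auto simp: a_def eq)
qed

text \<open>A function that starts at or below zero and is positive somewhere had a positive derivative
  before; if a positive derivative stays positive, so does the function.\<close>

lemma positive_persists:
  fixes h h' :: "real \<Rightarrow> real"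
  assumes h0: "h 0 \<le> 0" and der: "\<And>x. (h has_real_derivative h' x) (at x)"
    and h': "\<And>y z. 0 \<le> y \<Longrightarrow> y \<le> z \<Longrightarrow> 0 < h' y \<Longrightarrow> 0 < h' z"
    and y: "0 \<le> y" "y \<le> z" "0 < h y"
  shows "0 < h z"
proof -
  have "0 < y" using y h0 by (cases "y = 0") auto
  then obtain w where w: "0 < w" "w < y" "h y - h 0 = (y - 0) * h' w"
    using MVT2[of 0 y h h'] der by auto
  then have "0 < h' w" using y h0 \<open>0 < y\<close> by (smt (verit) mult_nonneg_nonpos)
  then have "0 \<le> h' x" if "y \<le> x" for x using h'[of w x] w that by force
  then have "h y \<le> h z" using y der by (intro DERIV_nonneg_imp_nondecreasing[of y z h]) blast+
  then show ?thesis using y by simp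
qed

text \<open>Polya's inequality. Write \<open>D\<close> for the difference of the two sides. It vanishes at \<open>0\<close> and at
  infinity, and \<open>D' = - 4 \<phi> h\<close>, so it is enough that \<open>h\<close> remains positive once it is positive:
  then \<open>D\<close> first increases and afterwards decreases. The value \<open>c = 2 / \<pi>\<close> makes
  \<open>h'(v)\<close> a positive multiple of \<open>m (v\<^sup>2)\<close> for a function \<open>m\<close> with increasing
  derivative and \<open>m 0 = 0\<close>, so the persistence passes from \<open>m'\<close> to \<open>m\<close> and from \<open>h'\<close> to \<open>h\<close>.\<close>

lemma Polya_nonneg:
  assumes x: "0 \<le> x"
  shows "exp (- (2 / pi) * x\<^sup>2) \<le> 4 * Gauss_cdf x * (1 - Gauss_cdf x)"
proof -
  define c where "c = 2 / pi"
  let ?\<phi> = std_normal_density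
  define u where "u v = 2 * Gauss_cdf v - 1" for v
  define m where "m t = exp (- (1 - c) * t) - 1 + (2 * c - 1) * t" for t
  define h where "h v = u v - c / (2 * ?\<phi> 0) * (v * exp ((1 / 2 - c) * v\<^sup>2))" for v
  define D where "D v = 1 - (u v)\<^sup>2 - exp (- c * v\<^sup>2)" for v
  have \<phi>0: "?\<phi> 0 = 1 / sqrt (2 * pi)" by (simp add: std_normal_density_def)
  have c0: "c = 4 * (?\<phi> 0)\<^sup>2" by (simp add: c_def \<phi>0 power_divide)
  have \<phi>: "?\<phi> v = ?\<phi> 0 * exp (- v\<^sup>2 / 2)" for v by (simp add: std_normal_density_def)
  have \<phi>0p: "?\<phi> 0 > 0" by (simp add: \<phi>0)
  have du: "(u has_real_derivative 2 * ?\<phi> v) (at v)" for v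
    unfolding u_def[abs_def] by (auto intro!: derivative_eq_intros DERIV_Gauss_cdf)
  have u0: "u 0 = 0" using Gauss_cdf_minus[of 0] by (simp add: u_def)
  have mper: "0 < m z" if "0 \<le> y" "y \<le> z" "0 < m y" for y z
  proof (rule positive_persists[where h=m and h'="\<lambda>t. - (1 - c) * exp (- (1 - c) * t) + (2 * c - 1)"])
    show "(m has_real_derivative - (1 - c) * exp (- (1 - c) * t) + (2 * c - 1)) (at t)" for t
      unfolding m_def[abs_def] by (auto intro!: derivative_eq_intros)
    fix y z :: real assume yz: "0 \<le> y" "y \<le> z" and p: "0 < - (1 - c) * exp (- (1 - c) * y) + (2 * c - 1)"
    have "- (1 - c) * exp (- (1 - c) * y) \<le> - (1 - c) * exp (- (1 - c) * z)"
    proof (cases "1 - c \<ge> 0")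
      case True then show ?thesis using yz mult_left_mono_neg[of y z "c - 1"] by (intro mult_left_mono_neg) auto
    next
      case False then show ?thesis using yz mult_left_mono[of y z "c - 1"] by (intro mult_left_mono) auto
    qed
    then show "0 < - (1 - c) * exp (- (1 - c) * z) + (2 * c - 1)" using p by linarith
  qed (use that in \<open>auto simp: m_def\<close>)
  have hper: "0 < h z" if "0 \<le> y" "y \<le> z" "0 < h y" for y z
  proof (rule positive_persists[where h=h and h'="\<lambda>v. 2 * ?\<phi> v * exp ((1 - c) * v\<^sup>2) * m (v\<^sup>2)"])
    fix v
    have c1: "c / (2 * ?\<phi> 0) = 2 * ?\<phi> 0" using \<phi>0p by (simp add: c0 power2_eq_square)
    have e1: "exp ((1 / 2 - c) * v\<^sup>2) = exp (- v\<^sup>2 / 2) * exp ((1 - c) * v\<^sup>2)"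
      unfolding exp_add[symmetric] by (simp add: algebra_simps)
    have e2: "exp ((1 - c) * v\<^sup>2) * exp (- (1 - c) * v\<^sup>2) = 1"
      unfolding exp_add[symmetric] by (simp add: left_diff_distrib)
    have s1: "2 * ?\<phi> 0 * (exp ((1 / 2 - c) * v\<^sup>2) + v * (exp ((1 / 2 - c) * v\<^sup>2) * ((1 / 2 - c) * (2 * v))))
       = 2 * ?\<phi> v * exp ((1 - c) * v\<^sup>2) * (1 + (1 - 2 * c) * v\<^sup>2)"
      unfolding e1 \<phi>[of v] by (simp add: algebra_simps power2_eq_square)
    have s2: "2 * ?\<phi> v * exp ((1 - c) * v\<^sup>2) * exp (- (1 - c) * v\<^sup>2) = 2 * ?\<phi> v"
      unfolding mult.assoc e2 by simp
    have "(h has_real_derivative 2 * ?\<phi> v - 2 * ?\<phi> 0 * (exp ((1 / 2 - c) * v\<^sup>2) + v * (exp ((1 / 2 - c) * v\<^sup>2) * ((1 / 2 - c) * (2 * v))))) (at v)"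
      unfolding h_def[abs_def] c1 by (auto intro!: derivative_eq_intros du)
    also have "2 * ?\<phi> v - 2 * ?\<phi> 0 * (exp ((1 / 2 - c) * v\<^sup>2) + v * (exp ((1 / 2 - c) * v\<^sup>2) * ((1 / 2 - c) * (2 * v))))
       = 2 * ?\<phi> v * exp ((1 - c) * v\<^sup>2) * m (v\<^sup>2)"
    proof -
      have "X * E - X * (1 + (1 - 2 * c) * t) = X * (E - 1 + (2 * c - 1) * t)" for X E t :: real
        by (simp add: algebra_simps)
      from this[of "2 * ?\<phi> v * exp ((1 - c) * v\<^sup>2)" "exp (- (1 - c) * v\<^sup>2)" "v\<^sup>2"]
      show ?thesis unfolding s1 m_def s2 .
    qed
    finally show "(h has_real_derivative 2 * ?\<phi> v * exp ((1 - c) * v\<^sup>2) * m (v\<^sup>2)) (at v)" .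
  next
    fix y z :: real assume yz: "0 \<le> y" "y \<le> z" and p: "0 < 2 * ?\<phi> y * exp ((1 - c) * y\<^sup>2) * m (y\<^sup>2)"
    have pos: "0 < 2 * ?\<phi> v * exp ((1 - c) * v\<^sup>2)" for v
      using normal_density_pos[of 1 0 v] by simp
    have "0 < m (y\<^sup>2)" using zero_less_mult_pos[OF p pos] .
    then have "0 < m (z\<^sup>2)" using yz mper[of "y\<^sup>2" "z\<^sup>2"] power_mono[of y z 2] by simp
    then show "0 < 2 * ?\<phi> z * exp ((1 - c) * z\<^sup>2) * m (z\<^sup>2)" by (intro mult_pos_pos pos)
  qed (use that in \<open>auto simp: h_def u0\<close>)
  have dD: "(D has_real_derivative - 4 * ?\<phi> v * h v) (at v)" for v
  proof -
    have e: "exp (- c * v\<^sup>2) = exp (- v\<^sup>2 / 2) * exp ((1 / 2 - c) * v\<^sup>2)"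
      unfolding exp_add[symmetric] by (simp add: algebra_simps)
    have "(D has_real_derivative - (2 * u v * (2 * ?\<phi> v)) + exp (- c * v\<^sup>2) * (c * (2 * v))) (at v)"
      unfolding D_def[abs_def] by (auto intro!: derivative_eq_intros du simp: power2_eq_square)
    also have "- (2 * u v * (2 * ?\<phi> v)) + exp (- c * v\<^sup>2) * (c * (2 * v)) = - 4 * ?\<phi> v * h v"
      unfolding h_def \<phi>[of v] e using \<phi>0p by (simp add: field_simps)
    finally show ?thesis .
  qed
  have D0: "D 0 = 0" by (simp add: D_def u0)
  have "0 \<le> D x"
  proof (cases "\<exists>y. 0 \<le> y \<and> y \<le> x \<and> 0 < h y")
    case False
    have "D 0 \<le> D x"
    proof (rule DERIV_nonneg_imp_nondecreasing[OF x])
      fix y assume "0 \<le> y" "y \<le> x"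
      then have "h y \<le> 0" using False by force
      then have "0 \<le> - 4 * ?\<phi> y * h y" by (simp add: mult_nonneg_nonpos mult_nonpos_nonneg)
      then show "\<exists>l. (D has_real_derivative l) (at y) \<and> 0 \<le> l" using dD by blast
    qed
    then show ?thesis using D0 by simp
  next
    case True
    then obtain y where y: "0 \<le> y" "y \<le> x" "0 < h y" by blast
    have dec: "D z \<le> D x" if "x \<le> z" for z
    proof (rule DERIV_nonpos_imp_nonincreasing[OF that])
      fix w assume "x \<le> w" "w \<le> z"
      then have "0 < h w" using hper[of y w] y by auto
      then have "- 4 * ?\<phi> w * h w \<le> 0" by (auto intro: mult_nonneg_nonneg)
      then show "\<exists>l. (D has_real_derivative l) (at w) \<and> l \<le> 0" using dD by blast
    qed
    interpret real_distribution std_normal_distribution by (rule real_dist_normal_dist)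
    have "(u \<longlongrightarrow> 2 * 1 - 1) at_top"
      unfolding u_def[abs_def] by (intro tendsto_intros cdf_lim_at_top_prob)
    moreover have "((\<lambda>v. exp (- c * v\<^sup>2)) \<longlongrightarrow> 0) at_top"
    proof (rule filterlim_compose[OF exp_at_bot])
      show "filterlim (\<lambda>v::real. - c * v\<^sup>2) at_bot at_top"
        by (rule filterlim_tendsto_neg_mult_at_bot[OF tendsto_const])
           (auto simp: c_def intro!: filterlim_pow_at_top filterlim_ident)
    qed
    ultimately have "(D \<longlongrightarrow> 1 - (2 * 1 - 1)\<^sup>2 - 0) at_top"
      unfolding D_def[abs_def] by (intro tendsto_intros)
    then have "(D \<longlongrightarrow> 0) at_top" by simp
    then show ?thesis
      by (rule tendsto_upperbound) (auto simp: eventually_at_top_linorder intro!: exI[of _ x] dec)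
  qed
  then show ?thesis by (simp add: D_def u_def c_def power2_eq_square algebra_simps)
qed

lemma Polya: "exp (- (2 / pi) * x\<^sup>2) \<le> 4 * Gauss_cdf x * (1 - Gauss_cdf x)"
proof (cases "0 \<le> x")
  case True then show ?thesis by (rule Polya_nonneg)
next
  case False
  then show ?thesis using Polya_nonneg[of "- x"] by (simp add: Gauss_cdf_minus algebra_simps)
qed

lemma Gauss_cdf_01: "0 < Gauss_cdf x" "Gauss_cdf x < 1"
proof -
  interpret real_distribution std_normal_distribution by (rule real_dist_normal_dist)
  have "0 < 4 * Gauss_cdf x * (1 - Gauss_cdf x)" by (rule less_le_trans[OF _ Polya]) simp
  moreover have "0 \<le> Gauss_cdf x" "Gauss_cdf x \<le> 1" by (auto simp: cdf_nonneg cdf_bounded_prob)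
  ultimately show "0 < Gauss_cdf x" "Gauss_cdf x < 1" by (auto simp: zero_less_mult_iff)
qed

text \<open>Machin's formula with \<open>arctan x \<le> x\<close>.\<close>

lemma pi_le_3_2: "pi \<le> 3.2"
proof -
  have "arctan (1 / 5) \<le> 1 / 5"
  proof -
    have "arctan (1/5) - arctan 0 \<le> 1 / 5 - (0::real)"
    proof -
      have "(\<lambda>x. x - arctan x) 0 \<le> (\<lambda>x. x - arctan x) (1/5::real)"
        by (rule DERIV_nonneg_imp_nondecreasing)
           (auto intro!: exI derivative_eq_intros simp: add_nonneg_eq_0_iff inverse_le_1_iff)
      then show ?thesis by simp
    qed
    then show ?thesis by simp
  qed
  moreover have "0 \<le> arctan (1 / 239)" by simp
  ultimately show ?thesis using machin by linarith
qed

text \<open>Here \<open>r = \<phi>\<close>, so the mean is \<open>1 / sqrt \<pi>\<close>, and Polya's inequality bounds \<open>J - 1\<close> by a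
  Gaussian integral. With \<open>w = 1 / \<pi>\<close> this gives \<open>\<xi> \<le> 2 (1 - w) / sqrt (3 - 4 w)\<close>.\<close>

lemma (in prob_space) probit_bound:
  assumes rl: "random_label_model M N U f S Y"
    and G: "distributed M lborel G (\<lambda>x. ennreal (std_normal_density x))"
    and ind: "indep_rv M borel G (borel \<Otimes>\<^sub>M borel) (\<lambda>\<omega>. (S \<omega>, Y \<omega>))"
    and prob: "probit_model M U f" and \<delta>: "\<delta> > 1"
  shows "corr_LS M S Y \<delta> \<ge> 0.9804 * corr_opt M S Y G \<delta>"
proof -
  let ?\<phi> = std_normal_density
  define w where "w = 1 / pi"
  have w: "w \<ge> 0.3125" "w \<le> 1/2" "w > 0" using pi_le_3_2 pi_ge_two by (auto simp: w_def divide_simps)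
  have \<phi>sq: "?\<phi> v * ?\<phi> v = 1 / (2 * pi) * exp (- v\<^sup>2)" for v
    by (simp add: std_normal_density_def exp_add[symmetric] field_simps)
  define R where "R = 1 / (2 * sqrt pi)"
  have R: "has_bochner_integral lborel (\<lambda>v. ?\<phi> v * ?\<phi> v) R"
  proof -
    have "?\<phi> v * ?\<phi> v = 1 / sqrt (2 * pi) * (?\<phi> v * exp (- (1/2) * v\<^sup>2) * exp (0 * v))" for v
      by (simp add: std_normal_density_def)
    moreover have "has_bochner_integral lborel (\<lambda>v. 1 / sqrt (2 * pi) * (?\<phi> v * exp (- (1/2) * v\<^sup>2) * exp (0 * v)))
       (1 / sqrt (2 * pi) * (1 / sqrt 2))"
      using std_normal_times_gauss_integral[of "1/2" 0] by (intro has_bochner_integral_mult_right) simp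
    moreover have "1 / sqrt (2 * pi) * (1 / sqrt 2) = R" by (simp add: R_def real_sqrt_mult)
    ultimately show ?thesis by simp
  qed
  have R2: "(2 * R)\<^sup>2 = w" by (simp add: R_def w_def power_divide)
  define k where "k v = ?\<phi> v * ((?\<phi> v)\<^sup>2 / (Gauss_cdf v * (1 - Gauss_cdf v)))" for v
  define b where "b = 1 - 2 / pi"
  define B where "B v = 2 / pi * (?\<phi> v * exp (- b * v\<^sup>2) * exp (0 * v))" for v
  have b: "2 * b + 1 = 3 - 4 * w" by (simp add: b_def w_def)
  have Bi: "has_bochner_integral lborel B (2 * w * (1 / sqrt (3 - 4 * w)))"
    using has_bochner_integral_mult_right[OF std_normal_times_gauss_integral[of b 0], of "2 / pi"] w b
    unfolding B_def by (simp add: w_def)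
  have km[measurable]: "Gauss_cdf \<in> borel_measurable borel"
    by (intro borel_measurable_continuous_onI continuous_at_imp_continuous_on ballI DERIV_isCont[OF DERIV_Gauss_cdf])
  have k0: "0 \<le> k v" for v using Gauss_cdf_01[of v] by (simp add: k_def)
  have kB: "k v \<le> B v" for v
  proof -
    have "(?\<phi> v)\<^sup>2 / (Gauss_cdf v * (1 - Gauss_cdf v)) \<le> (?\<phi> v)\<^sup>2 / (exp (- (2 / pi) * v\<^sup>2) / 4)"
      using Polya[of v] Gauss_cdf_01[of v] by (intro divide_left_mono) (auto intro!: mult_pos_pos)
    also have "\<dots> = 2 / pi * (exp (- v\<^sup>2) / exp (- (2 / pi) * v\<^sup>2))"
      unfolding power2_eq_square[of "?\<phi> v"] \<phi>sq by simp
    also have "exp (- v\<^sup>2) / exp (- (2 / pi) * v\<^sup>2) = exp (- b * v\<^sup>2)"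
      unfolding exp_diff[symmetric] by (simp add: b_def algebra_simps)
    finally have "k v \<le> ?\<phi> v * (2 / pi * exp (- b * v\<^sup>2))"
      unfolding k_def by (intro mult_left_mono) auto
    then show ?thesis by (simp add: B_def mult_ac)
  qed
  have ki: "integrable lborel k"
  proof (rule Bochner_Integration.integrable_bound[of _ B])
    show "integrable lborel B" using Bi by (simp add: has_bochner_integral_iff)
    show "k \<in> borel_measurable lborel" unfolding k_def[abs_def] by measurable
    show "AE v in lborel. norm (k v) \<le> norm (B v)"
      using k0 kB by (intro AE_I2) (smt (verit) real_norm_def)
  qed
  define K where "K = (\<integral>v. k v \<partial>lborel)"
  have K: "has_bochner_integral lborel k K" using ki by (simp add: K_def has_bochner_integral_iff)
  have KB: "K \<le> 2 * w * (1 / sqrt (3 - 4 * w))"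
    using integral_mono[OF ki _ kB] Bi by (simp add: K_def has_bochner_integral_iff)
  show ?thesis
  proof (rule symmetric_label_bound[OF rl G ind _ DERIV_Gauss_cdf Gauss_cdf_01(1) Gauss_cdf_minus _ R _ K[unfolded k_def] _ _ \<delta>])
    show "prob {\<omega> \<in> space M. f (U \<omega>) s = 1} = Gauss_cdf s" for s
      using prob by (simp add: probit_model_def)
    show "?\<phi> (- s) = ?\<phi> s" for s by (simp add: std_normal_density_def)
    show "0 < R" by (simp add: R_def)
    have "K * ((1 - (2 * R)\<^sup>2) / (2 * R)\<^sup>2) \<le> 2 * w * (1 / sqrt (3 - 4 * w)) * ((1 - w) / w)"
      unfolding R2 using KB w by (intro mult_right_mono) auto
    also have "\<dots> = 2 * (1 - w) / sqrt (3 - 4 * w)" using w by simp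
    also have "\<dots> \<le> 1.0403"
    proof -
      \<comment> \<open>The squared inequality is quadratic in \<open>w\<close> and holds between its two roots, which enclose
        \<open>[0.3125, 0.6]\<close>.\<close>
      have "0 \<le> (w - 0.3125) * (0.6 - w)" using w by simp
      moreover have "(w - 0.3125) * (0.6 - w) = 0.9125 * w - w * w - 0.1875"
        by (simp add: field_simps)
      ultimately have "w * w \<le> 0.9125 * w - 0.1875" by linarith
      then have "4 - 8 * w + 4 * (w * w) \<le> 1.0403\<^sup>2 * (3 - 4 * w)"
        using w by (simp add: power2_eq_square)
      then have "(2 * (1 - w))\<^sup>2 \<le> 1.0403\<^sup>2 * (3 - 4 * w)"
        by (simp add: power2_eq_square algebra_simps)
      then have "2 * (1 - w) \<le> sqrt (1.0403\<^sup>2 * (3 - 4 * w))" by (rule real_le_rsqrt)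
      also have "\<dots> = 1.0403 * sqrt (3 - 4 * w)" by (simp add: real_sqrt_mult)
      finally show ?thesis using w by (simp add: divide_le_eq)
    qed
    also have "\<dots> \<le> (1 / 0.9804)\<^sup>2" by (simp add: power2_eq_square)
    finally show "K * ((1 - (2 * R)\<^sup>2) / (2 * R)\<^sup>2) \<le> (1 / 0.9804)\<^sup>2" .
  qed simp
qed

section \<open>Least squares against the optimal convex loss\<close>

theorem mainTheorem4:
  fixes M :: "'a measure" and N :: "'u measure"
    and U :: "'a \<Rightarrow> 'u" and f :: "'u \<Rightarrow> real \<Rightarrow> real"
    and S Y G :: "'a \<Rightarrow> real"
  assumes "prob_space M"
    and "random_label_model M N U f S Y"
    and "distributed M lborel G (\<lambda>x. ennreal (std_normal_density x))"
    and "indep_rv M borel G (borel \<Otimes>\<^sub>M borel) (\<lambda>\<omega>. (S \<omega>, Y \<omega>))"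
  shows
    "(mean_SY M S Y > 0 \<and> has_diff_density M (\<lambda>\<omega>. S \<omega> * Y \<omega>) \<longrightarrow>
        (\<forall>\<delta>>1.
           ereal ((sigma_LS M S Y \<delta>)\<^sup>2 / (sigma_opt M S Y G \<delta>)\<^sup>2) \<le> xi M S Y \<and>
           ereal (corr_opt M S Y G \<delta> / corr_LS M S Y \<delta>) \<le> ereal_sqrt (xi M S Y)))
     \<and> (logistic_model M U f \<longrightarrow>
        (\<forall>\<delta>>1. corr_LS M S Y \<delta> \<ge> 0.9972 * corr_opt M S Y G \<delta>))
     \<and> (probit_model M U f \<longrightarrow>
        (\<forall>\<delta>>1. corr_LS M S Y \<delta> \<ge> 0.9804 * corr_opt M S Y G \<delta>))"
proof -
  interpret prob_space M by fact
  show ?thesis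
    using ratio_bounds_ereal[OF assms(2-4)] logistic_bound[OF assms(2-4)] probit_bound[OF assms(2-4)]
    by blast
qed

end
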